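(* Let $N\mathsf{Graph}$ be the quasicategory obtained as the localization of the category of simple graphs at the class of A-homotopy equivalences, realized as the cubical homotopy coherent nerve of the cubical category $\mathsf{Graph}$. Let $D \colon \Lambda^2_0 \to N\mathsf{Graph}$ be the span \[ I_0 \leftarrow I_0 \sqcup I_0 \rightarrow I_0 \] in which both legs are the unique graph map $I_0 \sqcup I_0 \to I_0$. Then for every cone $\lambda$ under $D$ (i.e. a map $\Lambda^2_0 \star \Delta^0 \to N\mathsf{Graph}$ extending $D$) there exists a cone $\lambda'$ under $D$ such that there is no map of cones $\lambda \to \lambda'$ (i.e. no map $\Lambda^2_0 \star \Delta^1 \to N\mathsf{Graph}$ restricting to $\lambda$ on $\Lambda^2_0 \star \{0\}$ and to $\lambda'$ on $\Lambda^2_0 \star \{1\}$). In particular, the diagram $D$ does not have a pushout (colimit) in $N\mathsf{Graph}$. *)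

theory Defs
  imports "HOL-Library.FuncSet" "HOL-Library.Infinite_Typeclass"
begin

section \<open>Simplicial sets\<close>

text \<open>The morphisms \<open>[m] \<rightarrow> [n]\<close> of the simplex category.\<close>

definition simplex_op :: "nat \<Rightarrow> nat \<Rightarrow> (nat \<Rightarrow> nat) set" where
  "simplex_op m n = {\<alpha> \<in> {..m} \<rightarrow>\<^sub>E {..n}. mono_on {..m} \<alpha>}"

text \<open>The operator \<open>sact X m n \<alpha>\<close> sends \<open>n\<close>-simplices to \<open>m\<close>-simplices, for \<open>\<alpha> : [m] \<rightarrow> [n]\<close>.\<close>

record 's sset =
  simps :: "nat \<Rightarrow> 's set"
  sact :: "nat \<Rightarrow> nat \<Rightarrow> (nat \<Rightarrow> nat) \<Rightarrow> 's \<Rightarrow> 's"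

definition simplicial_set :: "'s sset \<Rightarrow> bool" where
  "simplicial_set X \<longleftrightarrow>
     (\<forall>m n. \<forall>\<alpha> \<in> simplex_op m n. \<forall>x \<in> simps X n. sact X m n \<alpha> x \<in> simps X m) \<and>
     (\<forall>n. \<forall>x \<in> simps X n. sact X n n (restrict id {..n}) x = x) \<and>
     (\<forall>l m n. \<forall>\<beta> \<in> simplex_op l m. \<forall>\<alpha> \<in> simplex_op m n. \<forall>x \<in> simps X n.
        sact X l m \<beta> (sact X m n \<alpha> x) = sact X l n (compose {..l} \<alpha> \<beta>) x)"

text \<open>
  A simplicial map is only constrained on simplices; equality of simplicial maps is always
  expressed simplex by simplex.
\<close>

definition simplicial_map :: "'s sset \<Rightarrow> 't sset \<Rightarrow> (nat \<Rightarrow> 's \<Rightarrow> 't) \<Rightarrow> bool" where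
  "simplicial_map X Y f \<longleftrightarrow>
     (\<forall>n. \<forall>x \<in> simps X n. f n x \<in> simps Y n) \<and>
     (\<forall>m n. \<forall>\<alpha> \<in> simplex_op m n. \<forall>x \<in> simps X n.
        f m (sact X m n \<alpha> x) = sact Y m n \<alpha> (f n x))"

definition std_simplex :: "nat \<Rightarrow> (nat \<Rightarrow> nat) sset" where
  "std_simplex n =
     \<lparr>simps = (\<lambda>m. simplex_op m n), sact = (\<lambda>l m \<alpha> x. compose {..l} x \<alpha>)\<rparr>"

definition horn :: "nat \<Rightarrow> nat \<Rightarrow> (nat \<Rightarrow> nat) sset" where
  "horn n k =
     \<lparr>simps = (\<lambda>m. {x \<in> simplex_op m n. \<exists>j \<le> n. j \<noteq> k \<and> j \<notin> x ` {..m}}),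
      sact = sact (std_simplex n)\<rparr>"

definition boundary :: "nat \<Rightarrow> (nat \<Rightarrow> nat) sset" where
  "boundary n =
     \<lparr>simps = (\<lambda>m. {x \<in> simplex_op m n. \<exists>j \<le> n. j \<notin> x ` {..m}}),
      sact = sact (std_simplex n)\<rparr>"

text \<open>The map \<open>\<Delta>\<^sup>0 \<rightarrow> \<Delta>\<^sup>n\<close> selecting the vertex \<open>k\<close>.\<close>

definition vertex_map :: "nat \<Rightarrow> nat \<Rightarrow> (nat \<Rightarrow> nat) \<Rightarrow> (nat \<Rightarrow> nat)" where
  "vertex_map k = (\<lambda>m x. \<lambda>i\<in>{..m}. k)"


subsection \<open>Joins\<close>

text \<open>
  An \<open>n\<close>-simplex of \<open>X \<star> Y\<close> is an \<open>n\<close>-simplex of \<open>X\<close>, an \<open>n\<close>-simplex of \<open>Y\<close>, or a pair of a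
  \<open>p\<close>-simplex of \<open>X\<close> and a \<open>q\<close>-simplex of \<open>Y\<close> with \<open>p + 1 + q = n\<close>. The dimensions are recorded
  because the underlying HOL element of a simplex need not determine its dimension.
\<close>

datatype ('s, 't) join_simplex =
  JLeft 's | JRight 't | JBoth nat nat 's 't

text \<open>
  For \<open>\<alpha> : [m] \<rightarrow> [p + 1 + q]\<close> the preimage of the initial segment \<open>[p]\<close> is an initial segment
  of \<open>[m]\<close>; \<open>c\<close> is its number of elements.
\<close>

definition join :: "'s sset \<Rightarrow> 't sset \<Rightarrow> ('s, 't) join_simplex sset" where
  "join X Y =
     \<lparr>simps = (\<lambda>n. JLeft ` simps X n \<union> JRight ` simps Y n \<union>
        {JBoth p q x y | p q x y. p + 1 + q = n \<and> x \<in> simps X p \<and> y \<in> simps Y q}),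
      sact = (\<lambda>m n \<alpha> z. case z of
          JLeft x \<Rightarrow> JLeft (sact X m n \<alpha> x)
        | JRight y \<Rightarrow> JRight (sact Y m n \<alpha> y)
        | JBoth p q x y \<Rightarrow>
            (let c = card {i. i \<le> m \<and> \<alpha> i \<le> p} in
             if c = m + 1 then JLeft (sact X m p \<alpha> x)
             else if c = 0 then JRight (sact Y m q (\<lambda>i\<in>{..m}. \<alpha> i - (p + 1)) y)
             else JBoth (c - 1) (m - c)
                    (sact X (c - 1) p (restrict \<alpha> {..c - 1}) x)
                    (sact Y (m - c) q (\<lambda>i\<in>{..m - c}. \<alpha> (i + c) - (p + 1)) y)))\<rparr>"

definition join_map ::
  "(nat \<Rightarrow> 's \<Rightarrow> 's') \<Rightarrow> (nat \<Rightarrow> 't \<Rightarrow> 't') \<Rightarrow> nat \<Rightarrow> ('s, 't) join_simplex \<Rightarrow> ('s', 't') join_simplex"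
  where
  "join_map f g n z = (case z of
      JLeft x \<Rightarrow> JLeft (f n x)
    | JRight y \<Rightarrow> JRight (g n y)
    | JBoth p q x y \<Rightarrow> JBoth p q (f p x) (g q y))"


subsection \<open>Cones and colimits\<close>

definition is_cone ::
  "'k sset \<Rightarrow> 's sset \<Rightarrow> (nat \<Rightarrow> 'k \<Rightarrow> 's) \<Rightarrow> (nat \<Rightarrow> ('k, nat \<Rightarrow> nat) join_simplex \<Rightarrow> 's) \<Rightarrow> bool"
  where
  "is_cone K S D c \<longleftrightarrow>
     simplicial_map (join K (std_simplex 0)) S c \<and>
     (\<forall>n. \<forall>x \<in> simps K n. c n (JLeft x) = D n x)"

definition is_cone_map ::
  "'k sset \<Rightarrow> 's sset \<Rightarrow> (nat \<Rightarrow> ('k, nat \<Rightarrow> nat) join_simplex \<Rightarrow> 's) \<Rightarrow>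
   (nat \<Rightarrow> ('k, nat \<Rightarrow> nat) join_simplex \<Rightarrow> 's) \<Rightarrow>
   (nat \<Rightarrow> ('k, nat \<Rightarrow> nat) join_simplex \<Rightarrow> 's) \<Rightarrow> bool" where
  "is_cone_map K S c c' h \<longleftrightarrow>
     simplicial_map (join K (std_simplex 1)) S h \<and>
     (\<forall>n. \<forall>z \<in> simps (join K (std_simplex 0)) n.
        h n (join_map (\<lambda>_ x. x) (vertex_map 0) n z) = c n z \<and>
        h n (join_map (\<lambda>_ x. x) (vertex_map 1) n z) = c' n z)"

text \<open>
  A cone is a colimit if it is an initial object of the quasicategory of cones, i.e. if every map
  \<open>K \<star> \<partial>\<Delta>\<^sup>n \<rightarrow> S\<close> with \<open>n > 0\<close> restricting to it along \<open>K \<star> {0}\<close> extends to \<open>K \<star> \<Delta>\<^sup>n\<close>.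
\<close>

definition is_colimit ::
  "'k sset \<Rightarrow> 's sset \<Rightarrow> (nat \<Rightarrow> 'k \<Rightarrow> 's) \<Rightarrow> (nat \<Rightarrow> ('k, nat \<Rightarrow> nat) join_simplex \<Rightarrow> 's) \<Rightarrow> bool"
  where
  "is_colimit K S D c \<longleftrightarrow>
     is_cone K S D c \<and>
     (\<forall>n > 0. \<forall>b. simplicial_map (join K (boundary n)) S b \<and>
        (\<forall>m. \<forall>z \<in> simps (join K (std_simplex 0)) m.
           b m (join_map (\<lambda>_ x. x) (vertex_map 0) m z) = c m z) \<longrightarrow>
        (\<exists>h. simplicial_map (join K (std_simplex n)) S h \<and>
           (\<forall>m. \<forall>z \<in> simps (join K (boundary n)) m. h m z = b m z)))"

text \<open>
  The span \<open>\<Lambda>\<^sup>2\<^sub>0 \<rightarrow> S\<close> whose values on the edges \<open>0 \<rightarrow> 1\<close> and \<open>0 \<rightarrow> 2\<close> are the \<open>1\<close>-simplices \<open>e\<^sub>1\<close>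
  and \<open>e\<^sub>2\<close> (which have to agree at their source). A simplex \<open>x\<close> of the horn lies on one of these two
  edges, and is there given by \<open>min 1 \<circ> x\<close>.
\<close>

definition horn_span :: "'s sset \<Rightarrow> 's \<Rightarrow> 's \<Rightarrow> nat \<Rightarrow> (nat \<Rightarrow> nat) \<Rightarrow> 's" where
  "horn_span S e\<^sub>1 e\<^sub>2 m x =
     sact S m 1 (\<lambda>i\<in>{..m}. min 1 (x i)) (if 2 \<in> x ` {..m} then e\<^sub>2 else e\<^sub>1)"


section \<open>Cubical sets\<close>

text \<open>
  Cubical sets with both kinds of connections, presented by operators: for an \<open>n\<close>-cube \<open>x\<close>, 
  \<^item> \<open>face (n - 1) i \<epsilon> x\<close> for \<open>i < n\<close> is the \<open>(n - 1)\<close>-cube \<open>x \<partial>\<^bsub>i+1,\<epsilon>\<^esub>\<close>,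
  \<^item> \<open>degen n i x\<close> for \<open>i \<le> n\<close> is the \<open>(n + 1)\<close>-cube \<open>x \<sigma>\<^bsub>i+1\<^esub>\<close>,
  \<^item> \<open>conn n i \<epsilon> x\<close> for \<open>i < n\<close> is the \<open>(n + 1)\<close>-cube \<open>x \<gamma>\<^bsub>i+1,\<epsilon>\<^esub>\<close>.
  Coordinates are counted from \<open>0\<close>, and \<open>\<epsilon>\<close> is \<open>False\<close> for \<open>0\<close> and \<open>True\<close> for \<open>1\<close>. The axioms are the
  cubical identities, i.e. the relations between the generators of the box category.
\<close>

record 'c cset =
  cubes :: "nat \<Rightarrow> 'c set"
  face :: "nat \<Rightarrow> nat \<Rightarrow> bool \<Rightarrow> 'c \<Rightarrow> 'c"
  degen :: "nat \<Rightarrow> nat \<Rightarrow> 'c \<Rightarrow> 'c"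
  conn :: "nat \<Rightarrow> nat \<Rightarrow> bool \<Rightarrow> 'c \<Rightarrow> 'c"

locale cubical_set =
  fixes X :: "'c cset"
  assumes face_closed: "x \<in> cubes X (Suc n) \<Longrightarrow> i \<le> n \<Longrightarrow> face X n i \<epsilon> x \<in> cubes X n"
    and degen_closed: "x \<in> cubes X n \<Longrightarrow> i \<le> n \<Longrightarrow> degen X n i x \<in> cubes X (Suc n)"
    and conn_closed: "x \<in> cubes X n \<Longrightarrow> i < n \<Longrightarrow> conn X n i \<epsilon> x \<in> cubes X (Suc n)"
    and face_face: "x \<in> cubes X (Suc (Suc n)) \<Longrightarrow> j \<le> i \<Longrightarrow> i \<le> n \<Longrightarrow>
      face X n i \<epsilon> (face X (Suc n) j \<epsilon>' x) = face X n j \<epsilon>' (face X (Suc n) (Suc i) \<epsilon> x)"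
    and degen_degen: "x \<in> cubes X n \<Longrightarrow> j \<le> i \<Longrightarrow> i \<le> n \<Longrightarrow>
      degen X (Suc n) j (degen X n i x) = degen X (Suc n) (Suc i) (degen X n j x)"
    and face_degen_eq: "x \<in> cubes X n \<Longrightarrow> i \<le> n \<Longrightarrow> face X n i \<epsilon> (degen X n i x) = x"
    and face_degen_gt: "x \<in> cubes X (Suc n) \<Longrightarrow> j \<le> i \<Longrightarrow> i \<le> n \<Longrightarrow>
      face X (Suc n) (Suc i) \<epsilon> (degen X (Suc n) j x) = degen X n j (face X n i \<epsilon> x)"
    and face_degen_lt: "x \<in> cubes X (Suc n) \<Longrightarrow> i \<le> j \<Longrightarrow> j \<le> n \<Longrightarrow>
      face X (Suc n) i \<epsilon> (degen X (Suc n) (Suc j) x) = degen X n j (face X n i \<epsilon> x)"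
    and conn_conn_lt: "x \<in> cubes X n \<Longrightarrow> i < j \<Longrightarrow> j < n \<Longrightarrow>
      conn X (Suc n) i \<epsilon> (conn X n j \<epsilon>' x) = conn X (Suc n) (Suc j) \<epsilon>' (conn X n i \<epsilon> x)"
    and conn_conn_eq: "x \<in> cubes X n \<Longrightarrow> i < n \<Longrightarrow>
      conn X (Suc n) i \<epsilon> (conn X n i \<epsilon> x) = conn X (Suc n) (Suc i) \<epsilon> (conn X n i \<epsilon> x)"
    and face_conn_lt: "x \<in> cubes X (Suc n) \<Longrightarrow> i \<le> j \<Longrightarrow> j < n \<Longrightarrow>
      face X (Suc n) i \<epsilon> (conn X (Suc n) (Suc j) \<epsilon>' x) = conn X n j \<epsilon>' (face X n i \<epsilon> x)"
    and face_conn_same: "x \<in> cubes X n \<Longrightarrow> j < n \<Longrightarrow> i = j \<or> i = Suc j \<Longrightarrow>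
      face X n i \<epsilon> (conn X n j \<epsilon> x) = x"
    and face_conn_opp: "x \<in> cubes X (Suc n) \<Longrightarrow> j \<le> n \<Longrightarrow> i = j \<or> i = Suc j \<Longrightarrow>
      face X (Suc n) i \<epsilon> (conn X (Suc n) j (\<not> \<epsilon>) x) = degen X n j (face X n j \<epsilon> x)"
    and face_conn_gt: "x \<in> cubes X (Suc n) \<Longrightarrow> j < i \<Longrightarrow> i \<le> n \<Longrightarrow>
      face X (Suc n) (Suc i) \<epsilon> (conn X (Suc n) j \<epsilon>' x) = conn X n j \<epsilon>' (face X n i \<epsilon> x)"
    and conn_degen_lt: "x \<in> cubes X n \<Longrightarrow> j \<le> i \<Longrightarrow> i < n \<Longrightarrow>
      conn X (Suc n) (Suc i) \<epsilon> (degen X n j x) = degen X (Suc n) j (conn X n i \<epsilon> x)"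
    and conn_degen_eq: "x \<in> cubes X n \<Longrightarrow> i \<le> n \<Longrightarrow>
      conn X (Suc n) i \<epsilon> (degen X n i x) = degen X (Suc n) i (degen X n i x)"
    and conn_degen_gt: "x \<in> cubes X n \<Longrightarrow> i < j \<Longrightarrow> j \<le> n \<Longrightarrow>
      conn X (Suc n) i \<epsilon> (degen X n j x) = degen X (Suc n) (Suc j) (conn X n i \<epsilon> x)"

definition empty_cset :: "'c cset" where
  "empty_cset = \<lparr>cubes = (\<lambda>_. {}), face = (\<lambda>_ _ _ x. x), degen = (\<lambda>_ _ x. x), conn = (\<lambda>_ _ _ x. x)\<rparr>"

primrec degen_iter :: "'c cset \<Rightarrow> nat \<Rightarrow> 'c \<Rightarrow> 'c" where
  "degen_iter X 0 x = x"
| "degen_iter X (Suc k) x = degen X k 0 (degen_iter X k x)"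


subsection \<open>The box category and its representables\<close>

definition tuples :: "nat \<Rightarrow> 'a list set" where
  "tuples n = {v. length v = n}"

text \<open>
  Coordinatewise descriptions of faces, degeneracies and connections. They are used both for
  \<open>[1]\<^sup>n\<close> (tuples of Booleans) and for \<open>I\<^sub>\<infinity>\<^sup>\<otimes>\<^sup>n\<close> (tuples of integers). The connection
  \<open>\<gamma>\<^bsub>i,0\<^esub>\<close> is given by the maximum, \<open>\<gamma>\<^bsub>i,1\<^esub>\<close> by the minimum.
\<close>

definition ins_coord :: "nat \<Rightarrow> 'a \<Rightarrow> 'a list \<Rightarrow> 'a list" where
  "ins_coord i a v = take i v @ a # drop i v"

definition del_coord :: "nat \<Rightarrow> 'a list \<Rightarrow> 'a list" where
  "del_coord i v = take i v @ drop (Suc i) v"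

definition merge_coord :: "nat \<Rightarrow> bool \<Rightarrow> 'a::linorder list \<Rightarrow> 'a list" where
  "merge_coord i \<epsilon> v =
     take i v @ (if \<epsilon> then min else max) (v ! i) (v ! Suc i) # drop (Suc (Suc i)) v"

text \<open>\<open>box_hom k n\<close> is the set of morphisms \<open>[1]\<^sup>k \<rightarrow> [1]\<^sup>n\<close> of the box category.\<close>

inductive_set box_hom_graph :: "(nat \<times> nat \<times> (bool list \<Rightarrow> bool list)) set" where
  box_id: "(n, n, restrict id (tuples n)) \<in> box_hom_graph"
| box_face: "(Suc k, n, f) \<in> box_hom_graph \<Longrightarrow> i \<le> k \<Longrightarrow>
    (k, n, compose (tuples k) f (ins_coord i \<epsilon>)) \<in> box_hom_graph"
| box_degen: "(k, n, f) \<in> box_hom_graph \<Longrightarrow> i \<le> k \<Longrightarrow>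
    (Suc k, n, compose (tuples (Suc k)) f (del_coord i)) \<in> box_hom_graph"
| box_conn: "(k, n, f) \<in> box_hom_graph \<Longrightarrow> i < k \<Longrightarrow>
    (Suc k, n, compose (tuples (Suc k)) f (merge_coord i \<epsilon>)) \<in> box_hom_graph"

definition box_hom :: "nat \<Rightarrow> nat \<Rightarrow> (bool list \<Rightarrow> bool list) set" where
  "box_hom k n = {f. (k, n, f) \<in> box_hom_graph}"

definition std_cube :: "nat \<Rightarrow> (bool list \<Rightarrow> bool list) cset" where
  "std_cube n =
     \<lparr>cubes = (\<lambda>k. box_hom k n),
      face = (\<lambda>k i \<epsilon> f. compose (tuples k) f (ins_coord i \<epsilon>)),
      degen = (\<lambda>k i f. compose (tuples (Suc k)) f (del_coord i)),
      conn = (\<lambda>k i \<epsilon> f. compose (tuples (Suc k)) f (merge_coord i \<epsilon>))\<rparr>"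


section \<open>Cubical categories\<close>

text \<open>
  Categories enriched in cubical sets with the geometric product. By the universal property of the
  geometric product (a Day convolution), the composition
  \<open>Map(x, y) \<otimes> Map(y, z) \<rightarrow> Map(x, z)\<close> is given by operations
  \<open>Map(x, y)\<^sub>m \<times> Map(y, z)\<^sub>n \<rightarrow> Map(x, z)\<^bsub>m+n\<^esub>\<close> that are natural in both variables.
\<close>

record ('o, 'c) ccat =
  objs :: "'o set"
  maps :: "'o \<Rightarrow> 'o \<Rightarrow> 'c cset"
  ident :: "'o \<Rightarrow> 'c"
  ccomp :: "'o \<Rightarrow> 'o \<Rightarrow> 'o \<Rightarrow> nat \<Rightarrow> nat \<Rightarrow> 'c \<Rightarrow> 'c \<Rightarrow> 'c"

locale cubical_category =
  fixes C :: "('o, 'c) ccat"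
  assumes maps_cubical: "x \<in> objs C \<Longrightarrow> y \<in> objs C \<Longrightarrow> cubical_set (maps C x y)"
    and ident_closed: "x \<in> objs C \<Longrightarrow> ident C x \<in> cubes (maps C x x) 0"
    and comp_closed: "\<lbrakk>x \<in> objs C; y \<in> objs C; z \<in> objs C;
        f \<in> cubes (maps C x y) m; g \<in> cubes (maps C y z) n\<rbrakk> \<Longrightarrow>
      ccomp C x y z m n f g \<in> cubes (maps C x z) (m + n)"
    and comp_face_left: "\<lbrakk>x \<in> objs C; y \<in> objs C; z \<in> objs C;
        f \<in> cubes (maps C x y) (Suc m); g \<in> cubes (maps C y z) n; i \<le> m\<rbrakk> \<Longrightarrow>
      ccomp C x y z m n (face (maps C x y) m i \<epsilon> f) g =
      face (maps C x z) (m + n) i \<epsilon> (ccomp C x y z (Suc m) n f g)"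
    and comp_face_right: "\<lbrakk>x \<in> objs C; y \<in> objs C; z \<in> objs C;
        f \<in> cubes (maps C x y) m; g \<in> cubes (maps C y z) (Suc n); i \<le> n\<rbrakk> \<Longrightarrow>
      ccomp C x y z m n f (face (maps C y z) n i \<epsilon> g) =
      face (maps C x z) (m + n) (m + i) \<epsilon> (ccomp C x y z m (Suc n) f g)"
    and comp_degen_left: "\<lbrakk>x \<in> objs C; y \<in> objs C; z \<in> objs C;
        f \<in> cubes (maps C x y) m; g \<in> cubes (maps C y z) n; i \<le> m\<rbrakk> \<Longrightarrow>
      ccomp C x y z (Suc m) n (degen (maps C x y) m i f) g =
      degen (maps C x z) (m + n) i (ccomp C x y z m n f g)"
    and comp_degen_right: "\<lbrakk>x \<in> objs C; y \<in> objs C; z \<in> objs C;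
        f \<in> cubes (maps C x y) m; g \<in> cubes (maps C y z) n; i \<le> n\<rbrakk> \<Longrightarrow>
      ccomp C x y z m (Suc n) f (degen (maps C y z) n i g) =
      degen (maps C x z) (m + n) (m + i) (ccomp C x y z m n f g)"
    and comp_conn_left: "\<lbrakk>x \<in> objs C; y \<in> objs C; z \<in> objs C;
        f \<in> cubes (maps C x y) m; g \<in> cubes (maps C y z) n; i < m\<rbrakk> \<Longrightarrow>
      ccomp C x y z (Suc m) n (conn (maps C x y) m i \<epsilon> f) g =
      conn (maps C x z) (m + n) i \<epsilon> (ccomp C x y z m n f g)"
    and comp_conn_right: "\<lbrakk>x \<in> objs C; y \<in> objs C; z \<in> objs C;
        f \<in> cubes (maps C x y) m; g \<in> cubes (maps C y z) n; i < n\<rbrakk> \<Longrightarrow>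
      ccomp C x y z m (Suc n) f (conn (maps C y z) n i \<epsilon> g) =
      conn (maps C x z) (m + n) (m + i) \<epsilon> (ccomp C x y z m n f g)"
    and comp_ident_left: "\<lbrakk>x \<in> objs C; y \<in> objs C; f \<in> cubes (maps C x y) n\<rbrakk> \<Longrightarrow>
      ccomp C x x y 0 n (ident C x) f = f"
    and comp_ident_right: "\<lbrakk>x \<in> objs C; y \<in> objs C; f \<in> cubes (maps C x y) n\<rbrakk> \<Longrightarrow>
      ccomp C x y y n 0 f (ident C y) = f"
    and comp_assoc: "\<lbrakk>w \<in> objs C; x \<in> objs C; y \<in> objs C; z \<in> objs C;
        f \<in> cubes (maps C w x) l; g \<in> cubes (maps C x y) m; h \<in> cubes (maps C y z) n\<rbrakk> \<Longrightarrow>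
      ccomp C w y z (l + m) n (ccomp C w x y l m f g) h =
      ccomp C w x z l (m + n) f (ccomp C x y z m n g h)"

text \<open>
  Functors of cubical categories. Both components are required to be \<open>undefined\<close> outside
  their domain, so that equality of functors is equality of HOL values.
\<close>

record ('o, 'c, 'p, 'd) cfun =
  fobj :: "'o \<Rightarrow> 'p"
  fmap :: "'o \<Rightarrow> 'o \<Rightarrow> nat \<Rightarrow> 'c \<Rightarrow> 'd"

locale cubical_functor =
  fixes A :: "('o, 'c) ccat" and B :: "('p, 'd) ccat" and F :: "('o, 'c, 'p, 'd) cfun"
  assumes fobj_closed: "fobj F \<in> objs A \<rightarrow>\<^sub>E objs B"
    and fmap_closed: "\<lbrakk>x \<in> objs A; y \<in> objs A\<rbrakk> \<Longrightarrow>
      fmap F x y k \<in> cubes (maps A x y) k \<rightarrow>\<^sub>E cubes (maps B (fobj F x) (fobj F y)) k"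
    and fmap_undefined: "x \<notin> objs A \<or> y \<notin> objs A \<Longrightarrow> fmap F x y k f = undefined"
    and fmap_face: "\<lbrakk>x \<in> objs A; y \<in> objs A; f \<in> cubes (maps A x y) (Suc k); i \<le> k\<rbrakk> \<Longrightarrow>
      fmap F x y k (face (maps A x y) k i \<epsilon> f) =
      face (maps B (fobj F x) (fobj F y)) k i \<epsilon> (fmap F x y (Suc k) f)"
    and fmap_degen: "\<lbrakk>x \<in> objs A; y \<in> objs A; f \<in> cubes (maps A x y) k; i \<le> k\<rbrakk> \<Longrightarrow>
      fmap F x y (Suc k) (degen (maps A x y) k i f) =
      degen (maps B (fobj F x) (fobj F y)) k i (fmap F x y k f)"
    and fmap_conn: "\<lbrakk>x \<in> objs A; y \<in> objs A; f \<in> cubes (maps A x y) k; i < k\<rbrakk> \<Longrightarrow>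
      fmap F x y (Suc k) (conn (maps A x y) k i \<epsilon> f) =
      conn (maps B (fobj F x) (fobj F y)) k i \<epsilon> (fmap F x y k f)"
    and fmap_ident: "x \<in> objs A \<Longrightarrow> fmap F x x 0 (ident A x) = ident B (fobj F x)"
    and fmap_comp: "\<lbrakk>x \<in> objs A; y \<in> objs A; z \<in> objs A;
        f \<in> cubes (maps A x y) m; g \<in> cubes (maps A y z) n\<rbrakk> \<Longrightarrow>
      fmap F x z (m + n) (ccomp A x y z m n f g) =
      ccomp B (fobj F x) (fobj F y) (fobj F z) m n (fmap F x y m f) (fmap F y z n g)"

definition cfun_comp ::
  "('o, 'c) ccat \<Rightarrow> ('p, 'd, 'q, 'e) cfun \<Rightarrow> ('o, 'c, 'p, 'd) cfun \<Rightarrow> ('o, 'c, 'q, 'e) cfun" where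
  "cfun_comp A G F =
     \<lparr>fobj = compose (objs A) (fobj G) (fobj F),
      fmap = (\<lambda>x y k f. if x \<in> objs A \<and> y \<in> objs A \<and> f \<in> cubes (maps A x y) k
        then fmap G (fobj F x) (fobj F y) k (fmap F x y k f) else undefined)\<rparr>"


subsection \<open>The cubical homotopy coherent nerve\<close>

text \<open>
  The cubical category \<open>\<CC>[n]\<close> with objects \<open>0, \<dots>, n\<close>. Here \<open>Map(i, j)\<close> is \<open>\<box>\<^bsup>j-i-1\<^esup>\<close> if \<open>i < j\<close>,
  \<open>\<box>\<^sup>0\<close> if \<open>i = j\<close>, and empty if \<open>i > j\<close>; the coordinates of \<open>\<box>\<^bsup>j-i-1\<^esup>\<close> correspond, in increasing
  order, to the objects strictly between \<open>i\<close> and \<open>j\<close>. For \<open>i < j < k\<close> the composition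
  \<open>\<box>\<^bsup>j-i-1\<^esup> \<otimes> \<box>\<^bsup>k-j-1\<^esup> = \<box>\<^bsup>k-i-2\<^esup> \<rightarrow> \<box>\<^bsup>k-i-1\<^esup>\<close> is the face
  inclusion that inserts \<open>1\<close> at the coordinate of the object \<open>j\<close>.
\<close>

definition path_ccat :: "nat \<Rightarrow> (nat, bool list \<Rightarrow> bool list) ccat" where
  "path_ccat n =
     \<lparr>objs = {..n},
      maps = (\<lambda>i j. if i \<le> j then std_cube (j - i - 1) else empty_cset),
      ident = (\<lambda>_. restrict id (tuples 0)),
      ccomp = (\<lambda>i j k a b f g. \<lambda>v\<in>tuples (a + b).
        f (take a v) @ (if i < j \<and> j < k then [True] else []) @ g (drop a v))\<rparr>"

text \<open>
  The functor \<open>\<CC>[m] \<rightarrow> \<CC>[n]\<close> induced by \<open>\<alpha> : [m] \<rightarrow> [n]\<close>. Identifying a vertex of \<open>Map(i, j)\<close> with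
  a set of objects strictly between \<open>i\<close> and \<open>j\<close>, it takes the image of this set
  under \<open>\<alpha>\<close> and discards the end points \<open>\<alpha> i\<close> and \<open>\<alpha> j\<close>.
\<close>

definition path_bits :: "(nat \<Rightarrow> nat) \<Rightarrow> nat \<Rightarrow> nat \<Rightarrow> bool list \<Rightarrow> bool list" where
  "path_bits \<alpha> i j u =
     map (\<lambda>p. \<exists>q. i < q \<and> q < j \<and> \<alpha> q = p \<and> u ! (q - i - 1)) [\<alpha> i + 1..<\<alpha> j]"

definition path_cfun ::
  "nat \<Rightarrow> (nat \<Rightarrow> nat) \<Rightarrow> (nat, bool list \<Rightarrow> bool list, nat, bool list \<Rightarrow> bool list) cfun" where
  "path_cfun m \<alpha> =
     \<lparr>fobj = restrict \<alpha> {..m},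
      fmap = (\<lambda>i j k f. if i \<le> m \<and> j \<le> m \<and> f \<in> cubes (maps (path_ccat m) i j) k
        then compose (tuples k) (path_bits \<alpha> i j) f else undefined)\<rparr>"

definition hc_nerve ::
  "('p, 'd) ccat \<Rightarrow> (nat, bool list \<Rightarrow> bool list, 'p, 'd) cfun sset" where
  "hc_nerve C =
     \<lparr>simps = (\<lambda>n. {F. cubical_functor (path_ccat n) C F}),
      sact = (\<lambda>m n \<alpha> F. cfun_comp (path_ccat m) F (path_cfun m \<alpha>))\<rparr>"

text \<open>
  The \<open>1\<close>-simplex given by a \<open>0\<close>-cube \<open>f\<close> of \<open>Map(x, y)\<close>: since \<open>\<box>\<^sup>0\<close> is terminal, its value
  on the \<open>k\<close>-cube of \<open>Map(0, 1) = \<box>\<^sup>0\<close> is an iterated degeneracy of \<open>f\<close>.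
\<close>

definition hc_edge ::
  "('p, 'd) ccat \<Rightarrow> 'p \<Rightarrow> 'p \<Rightarrow> 'd \<Rightarrow> (nat, bool list \<Rightarrow> bool list, 'p, 'd) cfun" where
  "hc_edge C x y f =
     \<lparr>fobj = (\<lambda>i\<in>{..1}. if i = 0 then x else y),
      fmap = (\<lambda>i j k c.
        if i \<le> 1 \<and> j \<le> 1 \<and> c \<in> cubes (maps (path_ccat 1) i j) k
        then if i < j then degen_iter (maps C x y) k f
             else let z = (if i = 0 then x else y) in degen_iter (maps C z z) k (ident C z)
        else undefined)\<rparr>"


section \<open>Graphs\<close>

text \<open>
  Simple graphs are represented by their reflexive closure, so that graph maps, which may
  contract edges, are the maps preserving the relation.
\<close>

record 'v graph =
  verts :: "'v set"
  edges :: "('v \<times> 'v) set"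

definition simple_graph :: "'v graph \<Rightarrow> bool" where
  "simple_graph G \<longleftrightarrow>
     edges G \<subseteq> verts G \<times> verts G \<and> (\<forall>x \<in> verts G. (x, x) \<in> edges G) \<and> sym (edges G)"

definition graph_hom :: "'v graph \<Rightarrow> 'w graph \<Rightarrow> ('v \<Rightarrow> 'w) set" where
  "graph_hom G H =
     {f \<in> verts G \<rightarrow>\<^sub>E verts H. \<forall>(x, y) \<in> edges G. (f x, f y) \<in> edges H}"

definition graph_iso :: "'v graph \<Rightarrow> 'w graph \<Rightarrow> bool" where
  "graph_iso G H \<longleftrightarrow> (\<exists>f. bij_betw f (verts G) (verts H) \<and>
     (\<forall>x \<in> verts G. \<forall>y \<in> verts G. (x, y) \<in> edges G \<longleftrightarrow> (f x, f y) \<in> edges H))"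

text \<open>The graph \<open>I\<^sub>n\<close>: a path with vertices \<open>0, \<dots>, n\<close>.\<close>

definition path_graph :: "nat \<Rightarrow> nat graph" where
  "path_graph n =
     \<lparr>verts = {..n}, edges = {(i, j). i \<le> n \<and> j \<le> n \<and> i \<le> Suc j \<and> j \<le> Suc i}\<rparr>"

definition graph_sum :: "'v graph \<Rightarrow> 'w graph \<Rightarrow> ('v + 'w) graph" where
  "graph_sum G H =
     \<lparr>verts = verts G <+> verts H,
      edges = map_prod Inl Inl ` edges G \<union> map_prod Inr Inr ` edges H\<rparr>"

text \<open>
  The internal hom for the box product of graphs: two graph maps \<open>f, g\<close> are adjacent iff they are
  the two ends of a map from the box product of \<open>G\<close> and \<open>I\<^sub>1\<close> to \<open>H\<close>.
\<close>

definition hom_graph :: "'v graph \<Rightarrow> 'w graph \<Rightarrow> ('v \<Rightarrow> 'w) graph" where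
  "hom_graph G H =
     \<lparr>verts = graph_hom G H,
      edges = {(f, g). f \<in> graph_hom G H \<and> g \<in> graph_hom G H \<and>
                 (\<forall>x \<in> verts G. (f x, g x) \<in> edges H)}\<rparr>"


subsection \<open>The cubical nerve of a graph\<close>

text \<open>The \<open>n\<close>-fold box product \<open>I\<^sub>\<infinity>\<^sup>\<otimes>\<^sup>n\<close> of the infinite path on the integers.\<close>

definition grid :: "nat \<Rightarrow> int list graph" where
  "grid n =
     \<lparr>verts = tuples n,
      edges = {(v, w). v \<in> tuples n \<and>
                 (w = v \<or> (\<exists>i < n. \<exists>a. \<bar>a - v ! i\<bar> \<le> 1 \<and> w = v[i := a]))}\<rparr>"

definition sign :: "bool \<Rightarrow> int" where
  "sign \<epsilon> = (if \<epsilon> then 1 else - 1)"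

definition stable :: "nat \<Rightarrow> nat \<Rightarrow> bool \<Rightarrow> (int list \<Rightarrow> 'a) \<Rightarrow> bool" where
  "stable n i \<epsilon> f \<longleftrightarrow> (\<exists>M \<ge> 0. \<forall>v \<in> tuples n. \<forall>a \<ge> M.
     f (v[i := sign \<epsilon> * a]) = f (v[i := sign \<epsilon> * M]))"

text \<open>
  The \<open>(i, \<epsilon>)\<close>-face of a stable map is obtained by inserting a sufficiently large value, with sign
  given by \<open>\<epsilon>\<close>, at the \<open>i\<close>-th coordinate.
\<close>

definition graph_nerve :: "'a graph \<Rightarrow> (int list \<Rightarrow> 'a) cset" where
  "graph_nerve G =
     \<lparr>cubes = (\<lambda>n. {f \<in> graph_hom (grid n) G. \<forall>i < n. \<forall>\<epsilon>. stable n i \<epsilon> f}),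
      face = (\<lambda>n i \<epsilon> f. \<lambda>w\<in>tuples n.
        THE y. \<exists>M \<ge> 0. \<forall>a \<ge> M. f (ins_coord i (sign \<epsilon> * a) w) = y),
      degen = (\<lambda>n i f. compose (tuples (Suc n)) f (del_coord i)),
      conn = (\<lambda>n i \<epsilon> f. compose (tuples (Suc n)) f (merge_coord i \<epsilon>))\<rparr>"


subsection \<open>The cubical category of graphs\<close>

text \<open>The vertices of the graphs are taken from the type \<open>'v\<close>, which plays the role of a universe.\<close>

definition Graph :: "('v graph, int list \<Rightarrow> 'v \<Rightarrow> 'v) ccat" where
  "Graph =
     \<lparr>objs = {G. simple_graph G},
      maps = (\<lambda>G H. graph_nerve (hom_graph G H)),
      ident = (\<lambda>G. \<lambda>v\<in>tuples 0. restrict id (verts G)),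
      ccomp = (\<lambda>G H K m n f g. \<lambda>v\<in>tuples (m + n).
        compose (verts G) (g (drop m v)) (f (take m v)))\<rparr>"

definition NGraph ::
  "(nat, bool list \<Rightarrow> bool list, 'v graph, int list \<Rightarrow> 'v \<Rightarrow> 'v) cfun sset" where
  "NGraph = hc_nerve Graph"

text \<open>The \<open>1\<close>-simplex of \<open>NGraph\<close> given by a graph map \<open>u : G \<rightarrow> H\<close>.\<close>

definition graph_edge ::
  "'v graph \<Rightarrow> 'v graph \<Rightarrow> ('v \<Rightarrow> 'v) \<Rightarrow>
   (nat, bool list \<Rightarrow> bool list, 'v graph, int list \<Rightarrow> 'v \<Rightarrow> 'v) cfun" where
  "graph_edge G H u = hc_edge Graph G H (\<lambda>v\<in>tuples 0. u)"

end

(*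
  A cone under D with tip H consists of two homotopies of graph maps from J to H, one over each copy
  of I. Evaluating them at the two vertices of J gives four paths in H that close up to a loop. A path
  in the cubical nerve is constant outside a bounded window, so this loop has a finite combinatorial
  length, bounded by some 8 K. Let the tip of the second cone be the cycle of length N > 8 K, the first
  homotopy going once around the cycle at one vertex of J, everything else being constant.

  A map of cones consists of two 3-simplices with a common face, each of which gives a 2-cube in the
  mapping graph from J to the cycle. For N > 4 the winding number around the boundary of a 2-cube is
  0. Summing over both 2-cubes and both vertices of J, the sides along the common face cancel, the
  sides through the one-vertex graph I cancel as well, and N is the winding number of the image of the
  first loop, which is at most 8 K in absolute value.
*)

theory Submission
  imports Defs
begin

section \<open>The box category\<close>

text \<open>The homotopies inside a map of cones can be arbitrarily long. What is controlled is the
  given cone, and a graph map from its tip to the cycle carries edges to edges or points, so it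
  cannot lengthen a path. The bound is therefore fixed before the cycle is chosen, and all remaining
  sides have to cancel exactly rather than be estimated. Each of the four paths moves only inside
  \<open>{-K..K}\<close> and winds at most \<open>2 * K\<close>, whence \<open>8 * K\<close>. Cycles
  of length 3 and 4 will not do, as they bound (possibly degenerate) squares.

  The other difficulty is the cone over the cycle: it has to be defined on simplices of every
  dimension, each a functor with values on cubes of every dimension. Two devices reduce this to
  formulas. Vertices of the join are labelled by \<open>0\<close>, \<open>1\<close>,
  \<open>2\<close> for the span and \<open>3\<close> for the tip, and a simplex is determined by its
  labels. Only maps from label \<open>0\<close> to label \<open>3\<close> vary; there a cube of the
  path category is read as a Boolean function that tells whether label \<open>1\<close> is visited,
  and counting thresholds turns this function into a position on the loop.\<close>

lemma ins_coord_tuples: "v \<in> tuples n \<Longrightarrow> i \<le> n \<Longrightarrow> ins_coord i a v \<in> tuples (Suc n)"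
  by (simp add: tuples_def ins_coord_def)

lemma del_coord_tuples: "v \<in> tuples (Suc n) \<Longrightarrow> i \<le> n \<Longrightarrow> del_coord i v \<in> tuples n"
  by (simp add: tuples_def del_coord_def)

lemma merge_coord_tuples: "v \<in> tuples (Suc n) \<Longrightarrow> i < n \<Longrightarrow> merge_coord i \<epsilon> v \<in> tuples n"
  by (simp add: tuples_def merge_coord_def)

lemma ins_coord_Cons [simp]: "ins_coord (Suc i) a (x # v) = x # ins_coord i a v"
  by (simp add: ins_coord_def)

lemma del_coord_Cons [simp]: "del_coord (Suc i) (x # v) = x # del_coord i v"
  by (simp add: del_coord_def)

lemma merge_coord_Cons [simp]: "merge_coord (Suc i) \<epsilon> (x # v) = x # merge_coord i \<epsilon> v"
  by (simp add: merge_coord_def)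

lemma ins_coord_0 [simp]: "ins_coord 0 a v = a # v"
  by (simp add: ins_coord_def)

lemma del_coord_0 [simp]: "del_coord 0 (x # v) = v"
  by (simp add: del_coord_def)

lemma merge_coord_0 [simp]:
  "merge_coord 0 \<epsilon> (x # y # v) = (if \<epsilon> then min else max) x y # v"
  by (simp add: merge_coord_def)

lemma tuples_Suc_conv: "v \<in> tuples (Suc n) \<longleftrightarrow> (\<exists>x w. v = x # w \<and> w \<in> tuples n)"
  by (auto simp: tuples_def length_Suc_conv)

lemma tuples_0 [simp]: "tuples 0 = {[]}"
  by (auto simp: tuples_def)

section \<open>Composition and tensor products in the box category\<close>

lemma box_hom_id: "restrict id (tuples n) \<in> box_hom n n"
  by (simp add: box_hom_def box_id)

lemma box_hom_funcset: "f \<in> box_hom k n \<Longrightarrow> f \<in> tuples k \<rightarrow>\<^sub>E tuples n"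
proof -
  have "f \<in> tuples k \<rightarrow>\<^sub>E tuples n" if "(k, n, f) \<in> box_hom_graph" for k n f
    using that
  proof induction
    case (box_id n)
    then show ?case by auto
  next
    case (box_face k n f i \<epsilon>)
    then show ?case by (auto simp: compose_def restrict_PiE_iff ins_coord_tuples dest: PiE_mem)
  next
    case (box_degen k n f i)
    then show ?case by (auto simp: compose_def restrict_PiE_iff del_coord_tuples dest: PiE_mem)
  next
    case (box_conn k n f i \<epsilon>)
    then show ?case by (auto simp: compose_def restrict_PiE_iff merge_coord_tuples dest: PiE_mem)
  qed
  then show "f \<in> box_hom k n \<Longrightarrow> f \<in> tuples k \<rightarrow>\<^sub>E tuples n"
    by (simp add: box_hom_def)
qed

lemma box_hom_length: "f \<in> box_hom k n \<Longrightarrow> length v = k \<Longrightarrow> length (f v) = n"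
  using box_hom_funcset[of f k n] by (auto simp: tuples_def)

text \<open>Box morphisms are generated by precomposition, so the induction runs over
  \<open>f\<close>: associativity moves its last generator outside, while \<open>g\<close> stays
  arbitrary.\<close>

lemma box_hom_compose:
  assumes "g \<in> box_hom l n" and "f \<in> box_hom k l"
  shows "compose (tuples k) g f \<in> box_hom k n"
proof -
  have "(k, n, compose (tuples k) g f) \<in> box_hom_graph"
    if "(k, l, f) \<in> box_hom_graph" "(l, n, g) \<in> box_hom_graph" for k l f
    using that
  proof (induction arbitrary: g)
    case (box_id m)
    then have "g \<in> tuples m \<rightarrow>\<^sub>E tuples n"
      using box_hom_funcset by (simp add: box_hom_def)
    then have "compose (tuples m) g (restrict id (tuples m)) = g"
      by (auto simp: compose_def PiE_iff extensional_def)
    then show ?case using box_id by metis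
  next
    case (box_face k l f i \<epsilon>)
    have "compose (tuples k) g (compose (tuples k) f (ins_coord i \<epsilon>)) =
        compose (tuples k) (compose (tuples (Suc k)) g f) (ins_coord i \<epsilon>)"
      using box_face by (auto simp: compose_def ins_coord_tuples)
    then show ?case
      using box_hom_graph.box_face[OF box_face.IH[OF box_face.prems] box_face.hyps(2)] by simp
  next
    case (box_degen k l f i)
    have "compose (tuples (Suc k)) g (compose (tuples (Suc k)) f (del_coord i)) =
        compose (tuples (Suc k)) (compose (tuples k) g f) (del_coord i)"
      using box_degen by (auto simp: compose_def del_coord_tuples)
    then show ?case
      using box_hom_graph.box_degen[OF box_degen.IH[OF box_degen.prems] box_degen.hyps(2)] by simp
  next
    case (box_conn k l f i \<epsilon>)
    have "compose (tuples (Suc k)) g (compose (tuples (Suc k)) f (merge_coord i \<epsilon>)) =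
        compose (tuples (Suc k)) (compose (tuples k) g f) (merge_coord i \<epsilon>)"
      using box_conn by (auto simp: compose_def merge_coord_tuples)
    then show ?case
      using box_hom_graph.box_conn[OF box_conn.IH[OF box_conn.prems] box_conn.hyps(2)] by simp
  qed
  then show ?thesis using assms by (simp add: box_hom_def)
qed

text \<open>Tensoring with the identity of \<open>[1]\<close> on the left shifts the index of every
  generator by one.\<close>

lemma box_hom_Cons:
  assumes "f \<in> box_hom k n"
  shows "(\<lambda>v\<in>tuples (Suc k). hd v # f (tl v)) \<in> box_hom (Suc k) (Suc n)"
proof -
  have "(Suc k, Suc n, \<lambda>v\<in>tuples (Suc k). hd v # f (tl v)) \<in> box_hom_graph"
    if "(k, n, f) \<in> box_hom_graph" for k n f
    using that
  proof induction
    case (box_id n)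
    have eq: "(\<lambda>v\<in>tuples (Suc n). hd v # restrict id (tuples n) (tl v)) =
        restrict id (tuples (Suc n))"
      by (auto simp: tuples_Suc_conv intro!: restrict_ext)
    then show ?case using box_hom_graph.box_id by metis
  next
    case (box_face k n f i \<epsilon>)
    have eq: "(\<lambda>v\<in>tuples (Suc k). hd v # compose (tuples k) f (ins_coord i \<epsilon>) (tl v)) =
        compose (tuples (Suc k)) (\<lambda>v\<in>tuples (Suc (Suc k)). hd v # f (tl v))
          (ins_coord (Suc i) \<epsilon>)"
      using box_face.hyps(2)
      by (auto simp: tuples_Suc_conv[of _ k] compose_def ins_coord_tuples
          intro!: restrict_ext)
    show ?case
      unfolding eq by (rule box_hom_graph.box_face[OF box_face.IH]) (use box_face.hyps(2) in simp)
  next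
    case (box_degen k n f i)
    have eq: "(\<lambda>v\<in>tuples (Suc (Suc k)). hd v # compose (tuples (Suc k)) f (del_coord i) (tl v)) =
        compose (tuples (Suc (Suc k))) (\<lambda>v\<in>tuples (Suc k). hd v # f (tl v))
          (del_coord (Suc i))"
      using box_degen.hyps(2)
      by (auto simp: tuples_Suc_conv[of _ "Suc k"] compose_def del_coord_tuples
          intro!: restrict_ext)
    show ?case
      unfolding eq by (rule box_hom_graph.box_degen[OF box_degen.IH]) (use box_degen.hyps(2) in simp)
  next
    case (box_conn k n f i \<epsilon>)
    have eq: "(\<lambda>v\<in>tuples (Suc (Suc k)). hd v # compose (tuples (Suc k)) f (merge_coord i \<epsilon>) (tl v)) =
        compose (tuples (Suc (Suc k))) (\<lambda>v\<in>tuples (Suc k). hd v # f (tl v))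
          (merge_coord (Suc i) \<epsilon>)"
      using box_conn.hyps(2)
      by (auto simp: tuples_Suc_conv[of _ "Suc k"] compose_def merge_coord_tuples
          intro!: restrict_ext)
    show ?case
      unfolding eq by (rule box_hom_graph.box_conn[OF box_conn.IH]) (use box_conn.hyps(2) in simp)
  qed
  then show ?thesis using assms by (simp add: box_hom_def)
qed

lemma box_hom_face:
  "f \<in> box_hom (Suc k) n \<Longrightarrow> i \<le> k \<Longrightarrow> compose (tuples k) f (ins_coord i \<epsilon>) \<in> box_hom k n"
  by (simp add: box_hom_def box_face)

lemma box_hom_degen:
  "f \<in> box_hom k n \<Longrightarrow> i \<le> k \<Longrightarrow> compose (tuples (Suc k)) f (del_coord i) \<in> box_hom (Suc k) n"
  by (simp add: box_hom_def box_degen)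

lemma box_hom_conn:
  "f \<in> box_hom k n \<Longrightarrow> i < k \<Longrightarrow> compose (tuples (Suc k)) f (merge_coord i \<epsilon>) \<in> box_hom (Suc k) n"
  by (simp add: box_hom_def box_conn)

lemma box_hom_const_Cons:
  assumes "f \<in> box_hom k n"
  shows "(\<lambda>v\<in>tuples k. \<epsilon> # f v) \<in> box_hom k (Suc n)"
proof -
  have "(\<lambda>v\<in>tuples k. \<epsilon> # f v) =
      compose (tuples k) (\<lambda>v\<in>tuples (Suc k). hd v # f (tl v)) (ins_coord 0 \<epsilon>)"
    by (auto simp: compose_def tuples_Suc_conv intro!: restrict_ext)
  then show ?thesis
    using box_hom_face[OF box_hom_Cons[OF assms]] by simp
qed

lemma tuples_addE:
  assumes "v \<in> tuples (a + b)"
  obtains v1 v2 where "v = v1 @ v2" "v1 \<in> tuples a" "v2 \<in> tuples b"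
  using assms that[of "take a v" "drop a v"] by (simp add: tuples_def)

lemma tuples_append: "v \<in> tuples a \<Longrightarrow> w \<in> tuples b \<Longrightarrow> v @ w \<in> tuples (a + b)"
  by (simp add: tuples_def)

lemma ins_coord_append: "i \<le> length v \<Longrightarrow> ins_coord i a (v @ w) = ins_coord i a v @ w"
  by (simp add: ins_coord_def)

lemma merge_coord_append: "Suc i < length v \<Longrightarrow> merge_coord i \<epsilon> (v @ w) = merge_coord i \<epsilon> v @ w"
  by (simp add: merge_coord_def nth_append)

text \<open>Needed because composition in \<open>path_ccat\<close> concatenates coordinates. A
  generator applied to the first block is the same generator applied to the concatenation; when
  \<open>f\<close> is an identity, \<open>box_hom_Cons\<close> is iterated on
  \<open>g\<close>.\<close>

lemma box_hom_append:
  assumes "f \<in> box_hom a m" and "g \<in> box_hom b n"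
  shows "(\<lambda>v\<in>tuples (a + b). f (take a v) @ g (drop a v)) \<in> box_hom (a + b) (m + n)"
proof -
  have "(a + b, m + n, \<lambda>v\<in>tuples (a + b). f (take a v) @ g (drop a v)) \<in> box_hom_graph"
    if "(a, m, f) \<in> box_hom_graph" for a m f
    using that
  proof induction
    case (box_id l)
    have "(\<lambda>v\<in>tuples (l + b). take l v @ g (drop l v)) \<in> box_hom (l + b) (l + n)"
    proof (induction l)
      case 0
      then show ?case
        using assms(2) box_hom_funcset[OF assms(2)] by (simp add: PiE_iff extensional_restrict)
    next
      case (Suc l)
      have "(\<lambda>v\<in>tuples (Suc l + b). take (Suc l) v @ g (drop (Suc l) v)) =
          (\<lambda>v\<in>tuples (Suc (l + b)).
             hd v # (\<lambda>v\<in>tuples (l + b). take l v @ g (drop l v)) (tl v))"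
        by (auto simp: tuples_Suc_conv intro!: restrict_ext)
      then show ?case using box_hom_Cons[OF Suc] by (metis add_Suc)
    qed
    moreover have "(\<lambda>v\<in>tuples (l + b). restrict id (tuples l) (take l v) @ g (drop l v)) =
        (\<lambda>v\<in>tuples (l + b). take l v @ g (drop l v))"
      by (auto simp: tuples_def intro!: restrict_ext)
    ultimately show ?case by (metis box_hom_def mem_Collect_eq)
  next
    case (box_face a m f i \<epsilon>)
    have eq: "(\<lambda>v\<in>tuples (a + b). compose (tuples a) f (ins_coord i \<epsilon>) (take a v) @ g (drop a v)) =
        compose (tuples (a + b)) (\<lambda>v\<in>tuples (Suc a + b). f (take (Suc a) v) @ g (drop (Suc a) v))
          (ins_coord i \<epsilon>)"
      using box_face.hyps(2)
      by (intro ext) (auto simp: compose_def ins_coord_append tuples_append ins_coord_tuples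
          tuples_def ins_coord_def Suc_diff_le drop_take)
    show ?case
      unfolding eq unfolding add_Suc
      by (rule box_hom_graph.box_face[OF box_face.IH[unfolded add_Suc]]) (use box_face.hyps(2) in simp)
  next
    case (box_degen a m f i)
    have eq: "(\<lambda>v\<in>tuples (Suc a + b). compose (tuples (Suc a)) f (del_coord i) (take (Suc a) v) @
          g (drop (Suc a) v)) =
        compose (tuples (Suc a + b)) (\<lambda>v\<in>tuples (a + b). f (take a v) @ g (drop a v))
          (del_coord i)"
      using box_degen.hyps(2)
      by (intro ext) (auto simp: compose_def tuples_def del_coord_def min_def drop_take)
    show ?case
      unfolding eq unfolding add_Suc
      by (rule box_hom_graph.box_degen[OF box_degen.IH[unfolded add_Suc]]) (use box_degen.hyps(2) in simp)
  next
    case (box_conn a m f i \<epsilon>)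
    have eq: "(\<lambda>v\<in>tuples (Suc a + b). compose (tuples (Suc a)) f (merge_coord i \<epsilon>) (take (Suc a) v) @
          g (drop (Suc a) v)) =
        compose (tuples (Suc a + b)) (\<lambda>v\<in>tuples (a + b). f (take a v) @ g (drop a v))
          (merge_coord i \<epsilon>)"
    proof (rule ext)
      fix v :: "bool list"
      show "(\<lambda>v\<in>tuples (Suc a + b). compose (tuples (Suc a)) f (merge_coord i \<epsilon>) (take (Suc a) v) @
          g (drop (Suc a) v)) v =
        compose (tuples (Suc a + b)) (\<lambda>v\<in>tuples (a + b). f (take a v) @ g (drop a v))
          (merge_coord i \<epsilon>) v"
      proof (cases "v \<in> tuples (Suc a + b)")
        case True
        then obtain v1 v2 where v: "v = v1 @ v2" "v1 \<in> tuples (Suc a)" "v2 \<in> tuples b"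
          by (rule tuples_addE)
        then have "merge_coord i \<epsilon> v = merge_coord i \<epsilon> v1 @ v2" "merge_coord i \<epsilon> v1 \<in> tuples a"
          using box_conn.hyps(2) by (auto simp: merge_coord_append merge_coord_tuples tuples_def)
            (simp add: merge_coord_def)
        then show ?thesis
          using True v by (auto simp: compose_def tuples_def)
      qed (simp add: compose_def)
    qed
    show ?case
      unfolding eq unfolding add_Suc
      by (rule box_hom_graph.box_conn[OF box_conn.IH[unfolded add_Suc]]) (use box_conn.hyps(2) in simp)
  qed
  then show ?thesis using assms(1) by (simp add: box_hom_def)
qed

text \<open>\<open>as\<close> labels the inputs, and output \<open>p\<close> is the disjunction of
  the inputs labelled \<open>p\<close>. With the labels in a list, rather than given by
  \<open>\<alpha>\<close> as in \<open>path_bits\<close>, they can be removed one at a time.\<close>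

definition block_bits :: "nat list \<Rightarrow> nat \<Rightarrow> nat \<Rightarrow> bool list \<Rightarrow> bool list" where
  "block_bits as lo hi u = map (\<lambda>p. (p, True) \<in> set (zip as u)) [lo..<hi]"

text \<open>For sorted labels only the front matters: a label outside the range is a degeneracy, an
  output without inputs a face at \<open>False\<close>, a repeated label a connection by maximum,
  and a label that occurs once an identity coordinate. Each case shortens the list or the
  range.\<close>

lemma block_bits_box_hom:
  "sorted as \<Longrightarrow> restrict (block_bits as lo hi) (tuples (length as)) \<in> box_hom (length as) (hi - lo)"
proof (induction "length as + (hi - lo)" arbitrary: as lo rule: less_induct)
  case less
  consider "as = []" "hi \<le> lo" | "as = []" "lo < hi"
    | a r where "as = a # r" "a < lo \<or> hi \<le> a"
    | a r where "as = a # r" "lo < a" "a < hi"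
    | r where "as = lo # lo # r" "lo < hi"
    | r where "as = lo # r" "lo < hi" "lo \<notin> set r"
  proof (cases as)
    case Nil
    then show ?thesis using that(1,2) by linarith
  next
    case (Cons a r)
    show ?thesis
    proof (cases "a = lo \<and> lo < hi")
      case True
      show ?thesis
      proof (cases "lo \<in> set r")
        case lo: True
        then obtain b s where r: "r = b # s" by (cases r) auto
        have "b = lo" using less.prems Cons True r lo by (auto intro: antisym)
        then show ?thesis using that(5) Cons r True by blast
      qed (use that(6) Cons True in blast)
    qed (use that(3,4) Cons in \<open>metis linorder_cases not_less\<close>)
  qed
  then show ?case
  proof cases
    case 1
    then have "restrict (block_bits as lo hi) (tuples (length as)) = restrict id (tuples 0)"
      by (auto simp: block_bits_def restrict_def)
    then show ?thesis using 1 box_hom_id[of 0] by simp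
  next
    case 2
    have IH: "restrict (block_bits [] (Suc lo) hi) (tuples 0) \<in> box_hom 0 (hi - Suc lo)"
      using less.hyps[of "[]" "Suc lo"] 2 by simp
    have "restrict (block_bits as lo hi) (tuples (length as)) =
        (\<lambda>v\<in>tuples 0. False # restrict (block_bits [] (Suc lo) hi) (tuples 0) v)"
      using 2 by (auto simp: block_bits_def restrict_def upt_rec[of lo])
    then show ?thesis using 2 box_hom_const_Cons[OF IH] by (simp add: Suc_diff_Suc)
  next
    case (3 a r)
    have IH: "restrict (block_bits r lo hi) (tuples (length r)) \<in> box_hom (length r) (hi - lo)"
      using less.hyps[of r lo] 3 less.prems by simp
    have "restrict (block_bits as lo hi) (tuples (length as)) =
        compose (tuples (Suc (length r))) (restrict (block_bits r lo hi) (tuples (length r)))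
          (del_coord 0)"
      using 3 by (auto simp: block_bits_def tuples_Suc_conv compose_def intro!: restrict_ext)
    then show ?thesis using 3 box_hom_degen[OF IH, of 0] by simp
  next
    case (4 a r)
    have IH: "restrict (block_bits as (Suc lo) hi) (tuples (length as)) \<in> box_hom (length as) (hi - Suc lo)"
      using less.hyps[of as "Suc lo"] 4 less.prems by simp
    have "lo \<notin> set as" using less.prems 4 by auto
    then have nin: "(lo, True) \<notin> set (zip as u)" for u by (metis set_zip_leftD)
    have "restrict (block_bits as lo hi) (tuples (length as)) =
        (\<lambda>v\<in>tuples (length as). False # restrict (block_bits as (Suc lo) hi) (tuples (length as)) v)"
      using 4 nin by (auto simp: block_bits_def upt_rec[of lo] intro!: restrict_ext)
    then show ?thesis using 4 box_hom_const_Cons[OF IH] by (simp add: Suc_diff_Suc)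
  next
    case (5 r)
    have IH: "restrict (block_bits (lo # r) lo hi) (tuples (Suc (length r))) \<in> box_hom (Suc (length r)) (hi - lo)"
      using less.hyps[of "lo # r" lo] 5 less.prems by simp
    have "restrict (block_bits as lo hi) (tuples (length as)) =
        compose (tuples (Suc (Suc (length r))))
          (restrict (block_bits (lo # r) lo hi) (tuples (Suc (length r)))) (merge_coord 0 False)"
      using 5 by (auto simp: block_bits_def tuples_Suc_conv compose_def max_def intro!: restrict_ext)
    then show ?thesis using 5 box_hom_conn[OF IH, of 0 False] by simp
  next
    case (6 r)
    have IH: "restrict (block_bits r (Suc lo) hi) (tuples (length r)) \<in> box_hom (length r) (hi - Suc lo)"
      using less.hyps[of r "Suc lo"] 6 less.prems by simp
    have nin: "(lo, True) \<notin> set (zip r u)" for u using 6 by (metis set_zip_leftD)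
    have "restrict (block_bits as lo hi) (tuples (length as)) =
        (\<lambda>v\<in>tuples (Suc (length r)). hd v # restrict (block_bits r (Suc lo) hi) (tuples (length r)) (tl v))"
      using 6 nin by (auto simp: block_bits_def tuples_Suc_conv upt_rec[of lo]
          intro!: restrict_ext)
    then show ?thesis using 6 box_hom_Cons[OF IH] by (simp add: Suc_diff_Suc)
  qed
qed

text \<open>The labels are the values of \<open>\<alpha>\<close> at the objects strictly between
  \<open>i\<close> and \<open>j\<close>, sorted by monotonicity; values equal to an end point fall
  outside the range of outputs and are discarded.\<close>

lemma path_bits_box_hom:
  assumes "mono_on {..m} \<alpha>" and "i \<le> j" and "j \<le> m"
    and "f \<in> box_hom k (j - i - 1)"
  shows "compose (tuples k) (path_bits \<alpha> i j) f \<in> box_hom k (\<alpha> j - \<alpha> i - 1)"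
proof -
  let ?as = "map \<alpha> [i + 1..<j]"
  have len: "length ?as = j - i - 1" by simp
  have "sorted ?as"
    using assms(1,3) by (auto simp: sorted_iff_nth_mono intro!: mono_onD[of "{..m}" \<alpha>])
  then have "restrict (block_bits ?as (\<alpha> i + 1) (\<alpha> j)) (tuples (j - i - 1)) \<in>
      box_hom (j - i - 1) (\<alpha> j - \<alpha> i - 1)"
    using block_bits_box_hom[of ?as "\<alpha> i + 1" "\<alpha> j"] len by simp
  moreover have "block_bits ?as (\<alpha> i + 1) (\<alpha> j) u = path_bits \<alpha> i j u"
    if "u \<in> tuples (j - i - 1)" for u
  proof -
    have "((p, True) \<in> set (zip ?as u)) = (\<exists>q. i < q \<and> q < j \<and> \<alpha> q = p \<and> u ! (q - i - 1))" for p
    proof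
      assume "(p, True) \<in> set (zip ?as u)"
      then obtain r where "r < j - i - 1" "\<alpha> (i + 1 + r) = p" "u ! r"
        using that by (auto simp: set_zip tuples_def)
      then show "\<exists>q. i < q \<and> q < j \<and> \<alpha> q = p \<and> u ! (q - i - 1)"
        by (intro exI[of _ "i + 1 + r"]) auto
    next
      assume "\<exists>q. i < q \<and> q < j \<and> \<alpha> q = p \<and> u ! (q - i - 1)"
      then obtain q where "i < q" "q < j" "\<alpha> q = p" "u ! (q - i - 1)" by blast
      then show "(p, True) \<in> set (zip ?as u)"
        using that by (auto simp: set_zip tuples_def intro!: exI[of _ "q - i - 1"])
    qed
    then show ?thesis by (simp add: block_bits_def path_bits_def)
  qed
  ultimately show ?thesis
    using box_hom_compose[OF _ assms(4)] box_hom_funcset[OF assms(4)]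
    by (force simp: compose_def PiE_iff cong: restrict_cong)
qed

section \<open>Cubes in the nerve of a graph\<close>

lemma face_graph_nerve_eqI:
  assumes "w \<in> tuples n" and "M \<ge> 0"
    and "\<And>a. a \<ge> M \<Longrightarrow> f (ins_coord i (sign \<epsilon> * a) w) = y"
  shows "face (graph_nerve G) n i \<epsilon> f w = y"
proof -
  have "(THE y. \<exists>M \<ge> 0. \<forall>a \<ge> M. f (ins_coord i (sign \<epsilon> * a) w) = y) = y"
  proof (rule the_equality)
    fix y' assume "\<exists>M \<ge> 0. \<forall>a \<ge> M. f (ins_coord i (sign \<epsilon> * a) w) = y'"
    then obtain M' where "\<forall>a \<ge> M'. f (ins_coord i (sign \<epsilon> * a) w) = y'" by blast
    then show "y' = y" using assms(3)[of "max M M'"] by (metis max.cobounded1 max.cobounded2)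
  qed (use assms in blast)
  then show ?thesis using assms(1) by (simp add: graph_nerve_def)
qed

lemma ins_coord_update: "i \<le> length w \<Longrightarrow> (ins_coord i b w)[i := a] = ins_coord i a w"
  by (simp add: ins_coord_def list_update_append)

text \<open>
  If \<open>b\<close> is a lattice polynomial, i.e. a map \<open>[1]\<^sup>k \<rightarrow> [1]\<close> of the box category, then \<open>level N b\<close>
  is the same polynomial evaluated on integers, with values clamped to \<open>{0..N}\<close>: a value is
  recovered by counting the thresholds \<open>t\<close> below it. This makes sense for every Boolean function \<open>b\<close>
  and commutes with precomposition by faces, degeneracies and connections, so that a path of
  length \<open>N\<close> extends to cubes without any analysis of the box category.
\<close>

definition level :: "nat \<Rightarrow> (bool list \<Rightarrow> bool) \<Rightarrow> int list \<Rightarrow> nat" where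
  "level N b v = card {t \<in> {1..N}. b (map (\<lambda>x. int t \<le> x) v)}"

definition level_cube :: "nat \<Rightarrow> nat \<Rightarrow> (bool list \<Rightarrow> bool) \<Rightarrow> (nat \<Rightarrow> 'a) \<Rightarrow> int list \<Rightarrow> 'a" where
  "level_cube N k b h = (\<lambda>v\<in>tuples k. h (level N b v))"

lemma level_le: "level N b v \<le> N"
proof -
  have "level N b v \<le> card {1..N}" unfolding level_def by (rule card_mono) auto
  then show ?thesis by simp
qed

lemma level_True: "(\<And>w. length w = length v \<Longrightarrow> b w) \<Longrightarrow> level N b v = N"
proof -
  assume "\<And>w. length w = length v \<Longrightarrow> b w"
  then have "{t \<in> {1..N}. b (map (\<lambda>x. int t \<le> x) v)} = {1..N}" by auto
  then show "level N b v = N" by (simp add: level_def)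
qed

lemma level_False: "(\<And>w. length w = length v \<Longrightarrow> \<not> b w) \<Longrightarrow> level N b v = 0"
  by (simp add: level_def)

lemma level_cong:
  "(\<And>t. t \<in> {1..N} \<Longrightarrow> b (map (\<lambda>x. int t \<le> x) v) = b' (map (\<lambda>x. int t \<le> x) v')) \<Longrightarrow>
     level N b v = level N b' v'"
  unfolding level_def by (rule arg_cong[where f = card]) auto

lemma level_cube_cong:
  "(\<And>w. w \<in> tuples k \<Longrightarrow> b w = b' w) \<Longrightarrow> level_cube N k b h = level_cube N k b' h"
  unfolding level_cube_def by (intro restrict_ext arg_cong[where f = h] level_cong)
    (auto simp: tuples_def)

text \<open>Comparison with \<open>c\<close> is monotone, so it carries minima and maxima of
  integers to those of Booleans.\<close>

lemma map_threshold_merge: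
  fixes v :: "int list"
  shows "Suc i < length v \<Longrightarrow>
    map (\<lambda>x. c \<le> x) (merge_coord i \<epsilon> v) = merge_coord i \<epsilon> (map (\<lambda>x. c \<le> x) v)"
  by (auto simp: merge_coord_def take_map drop_map min_def max_def)

text \<open>Thresholds lie in \<open>{1..N}\<close>, so a value of at least \<open>N\<close> passes
  all of them and its negative none: the inserted coordinate acts as the constant
  \<open>\<epsilon>\<close>.\<close>

lemma level_ins_coord:
  assumes "a \<ge> int N"
  shows "level N b (ins_coord i (sign \<epsilon> * a) w) = level N (b \<circ> ins_coord i \<epsilon>) w"
  using assms by (intro level_cong) (auto simp: ins_coord_def take_map drop_map sign_def)

lemma level_update:
  assumes "a \<ge> int N"
  shows "level N b (v[i := sign \<epsilon> * a]) = level N b (v[i := sign \<epsilon> * int N])"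
  using assms by (intro level_cong arg_cong[where f = b]) (auto simp: map_update sign_def)

text \<open>Moving one coordinate by one affects a single comparison, the one at
  \<open>t = max a (v ! i)\<close>, so at most one new threshold is counted, whatever
  \<open>b\<close> is.\<close>

lemma level_update_le:
  assumes "\<bar>a - v ! i\<bar> \<le> 1" and "i < length v"
  shows "level N b (v[i := a]) \<le> Suc (level N b v)"
proof -
  have "b (map (\<lambda>x. int t \<le> x) v)" if "int t \<noteq> max a (v ! i)" "b (map (\<lambda>x. int t \<le> x) (v[i := a]))" for t
  proof -
    have "map (\<lambda>x. int t \<le> x) (v[i := a]) = map (\<lambda>x. int t \<le> x) v"
      using that(1) assms by (intro nth_equalityI) (auto simp: nth_list_update)
    then show ?thesis using that(2) by simp
  qed
  then have "{t \<in> {1..N}. b (map (\<lambda>x. int t \<le> x) (v[i := a]))} \<subseteq>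
      insert (nat (max a (v ! i))) {t \<in> {1..N}. b (map (\<lambda>x. int t \<le> x) v)}"
    by fastforce
  then have "level N b (v[i := a]) \<le>
      card (insert (nat (max a (v ! i))) {t \<in> {1..N}. b (map (\<lambda>x. int t \<le> x) v)})"
    unfolding level_def by (intro card_mono) auto
  also have "\<dots> \<le> Suc (level N b v)"
    unfolding level_def by (rule card_insert_le_m1) auto
  finally show ?thesis .
qed

lemma level_cube_mem:
  assumes G: "simple_graph G"
    and h: "\<And>c. c \<le> N \<Longrightarrow> h c \<in> verts G"
    and adj: "\<And>c. c < N \<Longrightarrow> (h c, h (Suc c)) \<in> edges G"
  shows "level_cube N k b h \<in> cubes (graph_nerve G) k"
proof -
  have e: "(h c, h d) \<in> edges G" if "c \<le> N" "d \<le> N" "c \<le> Suc d" "d \<le> Suc c" for c d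
  proof -
    have "c = d \<or> c = Suc d \<or> d = Suc c" using that by linarith
    then show ?thesis
    proof (elim disjE)
      assume "c = d"
      then show ?thesis using G h[OF that(1)] unfolding simple_graph_def by blast
    next
      assume "c = Suc d"
      then have "(h d, h c) \<in> edges G" using adj[of d] that(1) by simp
      then show ?thesis using G unfolding simple_graph_def by (blast dest: symD)
    next
      assume "d = Suc c"
      then show ?thesis using adj[of c] that(2) by simp
    qed
  qed
  have "(h (level N b v), h (level N b (v[i := a]))) \<in> edges G"
    if "\<bar>a - v ! i\<bar> \<le> 1" "i < length v" for v :: "int list" and i a
  proof (rule e)
    show "level N b (v[i := a]) \<le> Suc (level N b v)"
      using level_update_le[OF that] .
    show "level N b v \<le> Suc (level N b (v[i := a]))"
      using level_update_le[of "v ! i" "v[i := a]" i N b] that by (simp add: abs_minus_commute)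
  qed (rule level_le)+
  moreover have "(h (level N b v), h (level N b v)) \<in> edges G" for v
    using e level_le by simp
  ultimately have "(level_cube N k b h v, level_cube N k b h w) \<in> edges G"
    if "(v, w) \<in> edges (grid k)" for v w
    using that unfolding grid_def level_cube_def tuples_def by fastforce
  then have "level_cube N k b h \<in> graph_hom (grid k) G"
    unfolding graph_hom_def using h[OF level_le]
    by (auto simp: level_cube_def grid_def)
  moreover have "stable k i \<epsilon> (level_cube N k b h)" for i \<epsilon>
    unfolding stable_def
  proof (intro exI[of _ "int N"] conjI ballI allI impI)
    fix v :: "int list" and a assume "v \<in> tuples k" "int N \<le> a"
    then show "level_cube N k b h (v[i := sign \<epsilon> * a]) = level_cube N k b h (v[i := sign \<epsilon> * int N])"
      using level_update[of N a b v i \<epsilon>] by (simp add: level_cube_def tuples_def)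
  qed simp
  ultimately show ?thesis by (simp add: graph_nerve_def)
qed

text \<open>With the two lemmas after it: the cubical operators act on \<open>b\<close> alone.
  Naturality of the simplices built below then comes down to composing Boolean functions.\<close>

lemma level_cube_face:
  assumes "i \<le> n"
  shows "face (graph_nerve G) n i \<epsilon> (level_cube N (Suc n) b h) =
    level_cube N n (b \<circ> ins_coord i \<epsilon>) h"
proof (rule ext)
  fix w
  show "face (graph_nerve G) n i \<epsilon> (level_cube N (Suc n) b h) w =
    level_cube N n (b \<circ> ins_coord i \<epsilon>) h w"
  proof (cases "w \<in> tuples n")
    case True
    then show ?thesis
      using assms by (intro face_graph_nerve_eqI[where M = "int N"])
        (simp_all add: level_cube_def ins_coord_tuples level_ins_coord)
  qed (simp add: graph_nerve_def level_cube_def)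
qed

lemma level_cube_degen:
  assumes "i \<le> n"
  shows "degen (graph_nerve G) n i (level_cube N n b h) =
    level_cube N (Suc n) (b \<circ> del_coord i) h"
proof -
  have "level N b (del_coord i v) = level N (b \<circ> del_coord i) v" for v :: "int list"
    by (intro level_cong) (simp add: del_coord_def take_map drop_map)
  then show ?thesis using assms
    by (auto simp: graph_nerve_def level_cube_def compose_def del_coord_tuples intro!: restrict_ext)
qed

lemma level_cube_conn:
  assumes "i < n"
  shows "conn (graph_nerve G) n i \<epsilon> (level_cube N n b h) =
    level_cube N (Suc n) (b \<circ> merge_coord i \<epsilon>) h"
proof -
  have "level N b (merge_coord i \<epsilon> v) = level N (b \<circ> merge_coord i \<epsilon>) v"
    if "v \<in> tuples (Suc n)" for v :: "int list"
    using assms that by (intro level_cong) (simp add: map_threshold_merge tuples_def)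
  then show ?thesis using assms
    by (auto simp: graph_nerve_def level_cube_def compose_def merge_coord_tuples intro!: restrict_ext)
qed

lemma level_cube_const: "(\<And>c. c \<le> N \<Longrightarrow> h c = y) \<Longrightarrow> level_cube N k b h = (\<lambda>v\<in>tuples k. y)"
  by (auto simp: level_cube_def level_le)

section \<open>Cubes in the path category\<close>

lemma path_ccat_objs [simp]: "objs (path_ccat n) = {..n}"
  by (simp add: path_ccat_def)

lemma path_ccat_cubes [simp]:
  "cubes (maps (path_ccat n) i j) k = (if i \<le> j then box_hom k (j - i - 1) else {})"
  by (simp add: path_ccat_def std_cube_def empty_cset_def)

lemma path_ccat_maps:
  "i \<le> j \<Longrightarrow> face (maps (path_ccat n) i j) k l \<epsilon> f = compose (tuples k) f (ins_coord l \<epsilon>)"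
  "i \<le> j \<Longrightarrow> degen (maps (path_ccat n) i j) k l f = compose (tuples (Suc k)) f (del_coord l)"
  "i \<le> j \<Longrightarrow> conn (maps (path_ccat n) i j) k l \<epsilon> f = compose (tuples (Suc k)) f (merge_coord l \<epsilon>)"
  by (simp_all add: path_ccat_def std_cube_def)

text \<open>If \<open>j\<close> is strictly intermediate, its bit \<open>True\<close> goes in front
  of the second block. If \<open>j\<close> is an end point, truncated subtraction makes the factor
  at that end zero-dimensional, so the dimensions still add up.\<close>

lemma path_ccat_comp:
  assumes "i \<le> j" "j \<le> l" and f: "f \<in> box_hom a (j - i - 1)" and g: "g \<in> box_hom b (l - j - 1)"
  shows "ccomp (path_ccat n) i j l a b f g \<in> box_hom (a + b) (l - i - 1)"
proof (cases "i < j \<and> j < l")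
  case True
  have "ccomp (path_ccat n) i j l a b f g =
      (\<lambda>v\<in>tuples (a + b). f (take a v) @ (\<lambda>v\<in>tuples b. True # g v) (drop a v))"
    using True by (auto simp: path_ccat_def tuples_def intro!: restrict_ext)
  moreover have "j - i - 1 + Suc (l - j - 1) = l - i - 1" using True by linarith
  ultimately show ?thesis
    using box_hom_append[OF f box_hom_const_Cons[OF g, of True]] by (simp only:)
next
  case False
  then have "ccomp (path_ccat n) i j l a b f g =
      (\<lambda>v\<in>tuples (a + b). f (take a v) @ g (drop a v))"
    by (auto simp: path_ccat_def)
  moreover have "j - i - 1 + (l - j - 1) = l - i - 1" using False assms by linarith
  ultimately show ?thesis
    using box_hom_append[OF f g] by simp
qed

lemma path_ccat_ident [simp]: "ident (path_ccat n) i = restrict id (tuples 0)"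
  by (simp add: path_ccat_def)

section \<open>The cone defined by a loop in a mapping graph\<close>

lemma Graph_simps [simp]:
  "objs Graph = {G. simple_graph G}"
  "maps Graph G H = graph_nerve (hom_graph G H)"
  "ident Graph G = (\<lambda>v\<in>tuples 0. restrict id (verts G))"
  by (simp_all add: Graph_def)

lemma graph_homD: "f \<in> graph_hom G H \<Longrightarrow> x \<in> verts G \<Longrightarrow> f x \<in> verts H"
  by (auto simp: graph_hom_def)

lemma graph_hom_extensional: "f \<in> graph_hom G H \<Longrightarrow> f \<in> extensional (verts G)"
  by (auto simp: graph_hom_def PiE_def)

lemma verts_hom_graph [simp]: "verts (hom_graph G H) = graph_hom G H"
  by (simp add: hom_graph_def)

lemma simple_graph_refl: "simple_graph G \<Longrightarrow> x \<in> verts G \<Longrightarrow> (x, x) \<in> edges G"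
  by (simp add: simple_graph_def)

lemma simple_graph_hom_graph:
  assumes "simple_graph H"
  shows "simple_graph (hom_graph G H)"
  using assms by (auto simp: simple_graph_def hom_graph_def sym_def dest: graph_homD)

lemma restrict_id_graph_hom: "simple_graph G \<Longrightarrow> restrict id (verts G) \<in> graph_hom G G"
  by (auto simp: graph_hom_def simple_graph_def)

lemma simplex_op_mono: "\<alpha> \<in> simplex_op m n \<Longrightarrow> i \<le> j \<Longrightarrow> j \<le> m \<Longrightarrow> \<alpha> i \<le> \<alpha> j"
  by (auto simp: simplex_op_def mono_on_def)

lemma simplex_op_le: "\<alpha> \<in> simplex_op m n \<Longrightarrow> i \<le> m \<Longrightarrow> \<alpha> i \<le> n"
  by (auto simp: simplex_op_def)

text \<open>
  The diagram \<open>I \<leftarrow> J \<rightarrow> I\<close>, both legs being \<open>u\<close>, and the tip \<open>G\<close> are placed at the vertices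
  \<open>1, 0, 2, 3\<close>. Both legs of the cone are \<open>leg\<close>; the homotopy over the vertex \<open>1\<close> is the loop \<open>R\<close>
  at \<open>leg \<circ> u\<close>, the one over \<open>2\<close> is constant.
\<close>

locale loop_cone =
  fixes I J G :: "'v graph" and u leg :: "'v \<Rightarrow> 'v" and N :: nat and R :: "nat \<Rightarrow> 'v \<Rightarrow> 'v"
  assumes graph_I: "simple_graph I" and graph_J: "simple_graph J" and graph_G: "simple_graph G"
    and u_hom: "u \<in> graph_hom J I" and leg_hom: "leg \<in> graph_hom I G"
    and R_hom: "c \<le> N \<Longrightarrow> R c \<in> graph_hom J G"
    and R_adj: "c < N \<Longrightarrow> (R c, R (Suc c)) \<in> edges (hom_graph J G)"
    and R_0: "R 0 = compose (verts J) leg u" and R_N: "R N = compose (verts J) leg u"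
begin

definition ob :: "nat \<Rightarrow> 'v graph" where
  "ob s = (if s = 0 then J else if s = 3 then G else I)"

text \<open>Only the pair \<open>0\<close>, \<open>3\<close> uses the position \<open>c\<close> on
  the loop. All other arrows are fixed, with \<open>leg\<close> leaving both copies of
  \<open>I\<close>.\<close>

definition arr :: "nat \<Rightarrow> nat \<Rightarrow> nat \<Rightarrow> 'v \<Rightarrow> 'v" where
  "arr s t c =
     (if t = 3 then (if s = 3 then restrict id (verts G) else if s = 0 then R c else leg)
      else if s = 0 \<and> t \<noteq> 0 then u else restrict id (verts (ob s)))"

text \<open>The bits of \<open>f w\<close> are the intermediate objects visited, and only those
  labelled \<open>1\<close> count. A map that always visits one factors through label
  \<open>1\<close> and sits at position \<open>N\<close> of the loop; a map that never does sits at
  position \<open>0\<close>.\<close>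

definition through_1 :: "(nat \<Rightarrow> nat) \<Rightarrow> nat \<Rightarrow> nat \<Rightarrow> (bool list \<Rightarrow> bool list) \<Rightarrow> bool list \<Rightarrow> bool" where
  "through_1 \<alpha> i j f w \<longleftrightarrow> (\<exists>q. i < q \<and> q < j \<and> \<alpha> q = 1 \<and> f w ! (q - i - 1))"

lemma through_1_compose:
  "w \<in> A \<Longrightarrow> through_1 \<alpha> i j (compose A f c) w = through_1 \<alpha> i j f (c w)"
  by (simp add: through_1_def compose_def)

definition simplex ::
  "nat \<Rightarrow> (nat \<Rightarrow> nat) \<Rightarrow> (nat, bool list \<Rightarrow> bool list, 'v graph, int list \<Rightarrow> 'v \<Rightarrow> 'v) cfun" where
  "simplex m \<alpha> =
     \<lparr>fobj = (\<lambda>i\<in>{..m}. ob (\<alpha> i)),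
      fmap = (\<lambda>i j k f. if i \<le> m \<and> j \<le> m \<and> f \<in> cubes (maps (path_ccat m) i j) k
        then level_cube N k (through_1 \<alpha> i j f) (arr (\<alpha> i) (\<alpha> j)) else undefined)\<rparr>"

text \<open>A simplex of the horn misses \<open>1\<close> or \<open>2\<close>, so these two labels
  never occur together.\<close>

definition admissible :: "nat \<Rightarrow> (nat \<Rightarrow> nat) \<Rightarrow> bool" where
  "admissible m \<alpha> \<longleftrightarrow> mono_on {..m} \<alpha> \<and> (\<forall>i\<le>m. \<alpha> i \<le> 3) \<and> \<not> (\<exists>i\<le>m. \<exists>j\<le>m. \<alpha> i = 1 \<and> \<alpha> j = 2)"

lemma admissible_mono: "admissible m \<alpha> \<Longrightarrow> i \<le> j \<Longrightarrow> j \<le> m \<Longrightarrow> \<alpha> i \<le> \<alpha> j"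
  by (auto simp: admissible_def mono_on_def)

lemma simple_graph_ob: "simple_graph (ob s)"
  by (simp add: ob_def graph_I graph_J graph_G)

lemma arr_hom:
  assumes "s \<le> t" "t \<le> 3" "c \<le> N"
  shows "arr s t c \<in> graph_hom (ob s) (ob t)"
  using assms u_hom leg_hom R_hom restrict_id_graph_hom[OF simple_graph_ob, of s] graph_G
  by (auto simp: arr_def ob_def restrict_id_graph_hom)

lemma arr_adj:
  assumes "s \<le> t" "t \<le> 3" "c < N"
  shows "(arr s t c, arr s t (Suc c)) \<in> edges (hom_graph (ob s) (ob t))"
proof (cases "s = 0 \<and> t = 3")
  case True
  then show ?thesis using R_adj assms by (simp add: arr_def ob_def)
next
  case False
  then have "arr s t (Suc c) = arr s t c" by (auto simp: arr_def)
  then show ?thesis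
    using arr_hom[of s t c] assms
    by (simp add: simple_graph_refl[OF simple_graph_hom_graph[OF simple_graph_ob]])
qed

lemma compose_id_right: "f \<in> graph_hom A B \<Longrightarrow> compose (verts A) f (restrict id (verts A)) = f"
  by (drule graph_hom_extensional) (auto simp: compose_def extensional_def)

lemma compose_id_left: "f \<in> graph_hom A B \<Longrightarrow> compose (verts A) (restrict id (verts B)) f = f"
  by (frule graph_hom_extensional) (auto simp: compose_def extensional_def graph_homD intro!: ext)

text \<open>A factor can be the varying arrow from \<open>0\<close> to \<open>3\<close> only if the
  composite is one too. With that case excluded all arrows are fixed, so the positions
  \<open>c\<close>, \<open>d\<close>, \<open>e\<close> may be unrelated.\<close>

lemma arr_comp:
  assumes "r \<le> s" "s \<le> t" "t \<le> 3" "\<not> (r = 0 \<and> t = 3)" "c \<le> N" "d \<le> N"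
  shows "compose (verts (ob r)) (arr s t d) (arr r s c) = arr r t e"
proof -
  note hom = arr_hom[OF assms(1) _ assms(5)] arr_hom[OF assms(2,3,6)]
  have "s \<le> 3" using assms by simp
  show ?thesis
  proof (cases "s = t")
    case True
    then have "arr s t d = restrict id (verts (ob s))" by (auto simp: arr_def ob_def)
    moreover have "arr r s c = arr r t e" using True assms(4) by (auto simp: arr_def)
    ultimately show ?thesis using compose_id_left[OF hom(1)[OF \<open>s \<le> 3\<close>]] by simp
  next
    case False
    show ?thesis
    proof (cases "t = 3")
      case True
      then have "r \<noteq> 0" "s \<noteq> 0" "s \<noteq> 3" "r \<noteq> 3" using False assms(1,4) \<open>s \<le> 3\<close> by auto
      then have "arr r s c = restrict id (verts (ob r))" "ob r = ob s" "arr s t d = arr r t e"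
        using True by (simp_all add: arr_def ob_def)
      then show ?thesis using compose_id_right[OF hom(2)] by simp
    next
      case t: False
      show ?thesis
      proof (cases "s = 0")
        case True
        then have "r = 0" using assms(1) by simp
        then have "arr r s c = restrict id (verts (ob s))" "arr s t d = arr r t e"
          using True t by (simp_all add: arr_def)
        then show ?thesis using compose_id_right[OF hom(2)] True \<open>r = 0\<close> by simp
      next
        case s: False
        then have st: "s = 1" "t = 2" using False t assms(2,3) by linarith+
        have "r = 0 \<or> r = 1" using assms(1) st(1) by linarith
        then show ?thesis
          using compose_id_left[OF u_hom] compose_id_left[OF restrict_id_graph_hom[OF graph_I]]
          unfolding st by (elim disjE) (simp_all add: arr_def ob_def)
      qed
    qed
  qed
qed

lemma simplex_fmap:
  "i \<le> j \<Longrightarrow> j \<le> m \<Longrightarrow> f \<in> box_hom k (j - i - 1) \<Longrightarrow>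
     fmap (simplex m \<alpha>) i j k f = level_cube N k (through_1 \<alpha> i j f) (arr (\<alpha> i) (\<alpha> j))"
  by (simp add: simplex_def)

lemma simplex_fobj: "i \<le> m \<Longrightarrow> fobj (simplex m \<alpha>) i = ob (\<alpha> i)"
  by (simp add: simplex_def)

text \<open>Only composites from label \<open>0\<close> to label \<open>3\<close> are in question,
  and the label of \<open>j\<close> decides. At \<open>0\<close> or \<open>3\<close> one factor is
  an identity and all objects labelled \<open>1\<close> lie on the side of the other factor, which
  therefore has the same level. At \<open>1\<close> the inserted \<open>True\<close> fixes the level
  to \<open>N\<close>; at \<open>2\<close> admissibility excludes label \<open>1\<close> and fixes
  it to \<open>0\<close>. In both cases the composite is \<open>leg\<close> after \<open>u\<close>,
  by \<open>R_N\<close> and \<open>R_0\<close>.\<close>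

lemma simplex_comp:
  assumes adm: "admissible m \<alpha>" and ijl: "i \<le> j" "j \<le> l" "l \<le> m"
    and f: "f \<in> box_hom a (j - i - 1)" and g: "g \<in> box_hom b (l - j - 1)"
  shows "fmap (simplex m \<alpha>) i l (a + b) (ccomp (path_ccat m) i j l a b f g) =
    ccomp Graph (ob (\<alpha> i)) (ob (\<alpha> j)) (ob (\<alpha> l)) a b
      (fmap (simplex m \<alpha>) i j a f) (fmap (simplex m \<alpha>) j l b g)"
proof -
  let ?h = "ccomp (path_ccat m) i j l a b f g"
  have h: "?h w = f (take a w) @ (if i < j \<and> j < l then [True] else []) @ g (drop a w)"
    if "w \<in> tuples (a + b)" for w
    using that by (simp add: path_ccat_def)
  have mono: "\<alpha> p \<le> \<alpha> q" if "p \<le> q" "q \<le> m" for p q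
    using admissible_mono[OF adm] that by blast
  have le: "\<alpha> i \<le> \<alpha> j" "\<alpha> j \<le> \<alpha> l" "\<alpha> l \<le> 3" using mono ijl adm by (auto simp: admissible_def)
  have "arr (\<alpha> i) (\<alpha> l) (level N (through_1 \<alpha> i l ?h) (v1 @ v2)) =
      compose (verts (ob (\<alpha> i))) (arr (\<alpha> j) (\<alpha> l) (level N (through_1 \<alpha> j l g) v2))
        (arr (\<alpha> i) (\<alpha> j) (level N (through_1 \<alpha> i j f) v1))"
    if v: "v1 \<in> tuples a" "v2 \<in> tuples b" for v1 v2
  proof (cases "\<alpha> i = 0 \<and> \<alpha> l = 3")
    case False
    show ?thesis by (rule arr_comp[OF le False level_le level_le, symmetric])
  next
    case True
    have len: "length (f w) = j - i - 1" "length (g w') = l - j - 1"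
      if "w \<in> tuples a" "w' \<in> tuples b" for w w'
      using box_hom_length[OF f] box_hom_length[OF g] that by (auto simp: tuples_def)
    consider "\<alpha> j = 0" | "\<alpha> j = 1" | "\<alpha> j = 2" | "\<alpha> j = 3" using le by linarith
    then show ?thesis
    proof cases
      case 1
      have "level N (through_1 \<alpha> i l ?h) (v1 @ v2) = level N (through_1 \<alpha> j l g) v2"
      proof (rule level_cong)
        fix t
        let ?w1 = "map (\<lambda>x. int t \<le> x) v1" and ?w2 = "map (\<lambda>x. int t \<le> x) v2"
        have w: "?w1 \<in> tuples a" "?w2 \<in> tuples b" using v by (auto simp: tuples_def)
        then have hw: "?h (?w1 @ ?w2) = f ?w1 @ (if i < j \<and> j < l then [True] else []) @ g ?w2"
          using h[of "?w1 @ ?w2"] by (simp add: tuples_def)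
        have "j < l" using 1 True ijl by (auto intro: le_neq_implies_less)
        have "?h (?w1 @ ?w2) ! (q - i - 1) = g ?w2 ! (q - j - 1)" if "j < q" "q < l" for q
          unfolding hw using len[OF w] that ijl \<open>j < l\<close> by (auto simp: nth_append nth_Cons')
        moreover have "j < q \<and> i < q" if "\<alpha> q = 1" for q
          using mono[of q j] that 1 ijl by (cases "q \<le> j") auto
        ultimately have "(i < q \<and> q < l \<and> \<alpha> q = 1 \<and> ?h (?w1 @ ?w2) ! (q - i - 1)) =
            (j < q \<and> q < l \<and> \<alpha> q = 1 \<and> g ?w2 ! (q - j - 1))" for q
          using ijl by (cases "\<alpha> q = 1") (auto simp del: One_nat_def)
        then show "through_1 \<alpha> i l ?h (map (\<lambda>x. int t \<le> x) (v1 @ v2)) =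
            through_1 \<alpha> j l g ?w2"
          unfolding through_1_def map_append by (simp only:)
      qed
      moreover have "compose (verts J) (R c) (restrict id (verts J)) = R c" if "c \<le> N" for c
        using compose_id_right[OF R_hom[OF that]] .
      ultimately show ?thesis using True 1 level_le by (simp add: arr_def ob_def)
    next
      case 2
      have ij: "i < j" "j < l" using 2 True ijl by (auto intro!: le_neq_implies_less)
      have "level N (through_1 \<alpha> i l ?h) (v1 @ v2) = N"
      proof (rule level_True)
        fix w :: "bool list" assume "length w = length (v1 @ v2)"
        then have w: "w \<in> tuples (a + b)" "take a w \<in> tuples a" using v by (auto simp: tuples_def)
        have "?h w ! (j - i - 1)"
          unfolding h[OF w(1)] using box_hom_length[OF f, of "take a w"] w(2) ij
          by (simp add: nth_append tuples_def)
        then show "through_1 \<alpha> i l ?h w" using ij 2 unfolding through_1_def by blast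
      qed
      then show ?thesis using True 2 R_N by (simp add: arr_def ob_def)
    next
      case 3
      have "level N (through_1 \<alpha> i l ?h) (v1 @ v2) = 0"
      proof (rule level_False)
        fix w
        show "\<not> through_1 \<alpha> i l ?h w"
        proof
          assume "through_1 \<alpha> i l ?h w"
          then obtain q where "q < l" "\<alpha> q = 1" unfolding through_1_def by blast
          then show False using adm 3 ijl unfolding admissible_def by (metis le_trans less_imp_le)
        qed
      qed
      then show ?thesis using True 3 R_0 by (simp add: arr_def ob_def)
    next
      case 4
      have "level N (through_1 \<alpha> i l ?h) (v1 @ v2) = level N (through_1 \<alpha> i j f) v1"
      proof (rule level_cong)
        fix t
        let ?w1 = "map (\<lambda>x. int t \<le> x) v1" and ?w2 = "map (\<lambda>x. int t \<le> x) v2"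
        have w: "?w1 \<in> tuples a" "?w2 \<in> tuples b" using v by (auto simp: tuples_def)
        then have hw: "?h (?w1 @ ?w2) = f ?w1 @ (if i < j \<and> j < l then [True] else []) @ g ?w2"
          using h[of "?w1 @ ?w2"] by (simp add: tuples_def)
        have "?h (?w1 @ ?w2) ! (q - i - 1) = f ?w1 ! (q - i - 1)" if "i < q" "q < j" for q
          unfolding hw using len[OF w] that by (auto simp: nth_append)
        moreover have "q < j" if "\<alpha> q = 1" "q < l" for q
          using mono[of j q] that 4 ijl by (auto intro: leI)
        ultimately have "(i < q \<and> q < l \<and> \<alpha> q = 1 \<and> ?h (?w1 @ ?w2) ! (q - i - 1)) =
            (i < q \<and> q < j \<and> \<alpha> q = 1 \<and> f ?w1 ! (q - i - 1))" for q
          using ijl by (cases "\<alpha> q = 1") (auto simp del: One_nat_def)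
        then show "through_1 \<alpha> i l ?h (map (\<lambda>x. int t \<le> x) (v1 @ v2)) =
            through_1 \<alpha> i j f ?w1"
          unfolding through_1_def map_append by (simp only:)
      qed
      moreover have "compose (verts J) (restrict id (verts G)) (R c) = R c" if "c \<le> N" for c
        using compose_id_left[OF R_hom[OF that]] .
      ultimately show ?thesis using True 4 level_le by (simp add: arr_def ob_def)
    qed
  qed
  then have "level_cube N (a + b) (through_1 \<alpha> i l ?h) (arr (\<alpha> i) (\<alpha> l)) =
      (\<lambda>v\<in>tuples (a + b). compose (verts (ob (\<alpha> i)))
        (level_cube N b (through_1 \<alpha> j l g) (arr (\<alpha> j) (\<alpha> l)) (drop a v))
        (level_cube N a (through_1 \<alpha> i j f) (arr (\<alpha> i) (\<alpha> j)) (take a v)))"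
    unfolding level_cube_def
    by (intro restrict_ext) (erule tuples_addE, simp add: tuples_def)
  then show ?thesis
    using simplex_fmap ijl f g path_ccat_comp[OF ijl(1,2) f g] by (simp add: Graph_def)
qed

lemma simplex_functor:
  assumes adm: "admissible m \<alpha>"
  shows "cubical_functor (path_ccat m) Graph (simplex m \<alpha>)"
proof
  note mono = admissible_mono[OF adm]
  have le3: "\<alpha> j \<le> 3" if "j \<le> m" for j using adm that by (simp add: admissible_def)
  show "fobj (simplex m \<alpha>) \<in> objs (path_ccat m) \<rightarrow>\<^sub>E objs Graph"
    by (simp add: simplex_def simple_graph_ob)
  show "fmap (simplex m \<alpha>) i j k \<in> cubes (maps (path_ccat m) i j) k \<rightarrow>\<^sub>E
      cubes (maps Graph (fobj (simplex m \<alpha>) i) (fobj (simplex m \<alpha>) j)) k"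
    if "i \<in> objs (path_ccat m)" "j \<in> objs (path_ccat m)" for i j k
  proof (rule PiE_I)
    fix f assume f: "f \<in> cubes (maps (path_ccat m) i j) k"
    then have ij: "i \<le> j" "f \<in> box_hom k (j - i - 1)" by (auto split: if_splits)
    show "fmap (simplex m \<alpha>) i j k f \<in> cubes (maps Graph (fobj (simplex m \<alpha>) i) (fobj (simplex m \<alpha>) j)) k"
      using that ij mono[of i j] le3[of j]
      by (auto simp: simplex_fmap simplex_fobj intro!: level_cube_mem simple_graph_hom_graph simple_graph_ob arr_adj arr_hom)
  qed (use that in \<open>simp add: simplex_def\<close>)
  show "fmap (simplex m \<alpha>) i j k f = undefined"
    if "i \<notin> objs (path_ccat m) \<or> j \<notin> objs (path_ccat m)" for i j k f
    using that by (auto simp: simplex_def)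
  show "fmap (simplex m \<alpha>) i j k (face (maps (path_ccat m) i j) k l \<epsilon> f) =
      face (maps Graph (fobj (simplex m \<alpha>) i) (fobj (simplex m \<alpha>) j)) k l \<epsilon> (fmap (simplex m \<alpha>) i j (Suc k) f)"
    if "i \<in> objs (path_ccat m)" "j \<in> objs (path_ccat m)"
      "f \<in> cubes (maps (path_ccat m) i j) (Suc k)" "l \<le> k" for i j k l \<epsilon> f
    using that
    by (auto simp: simplex_fmap simplex_fobj path_ccat_maps box_hom_face level_cube_face
        through_1_compose split: if_splits intro!: level_cube_cong)
  show "fmap (simplex m \<alpha>) i j (Suc k) (degen (maps (path_ccat m) i j) k l f) =
      degen (maps Graph (fobj (simplex m \<alpha>) i) (fobj (simplex m \<alpha>) j)) k l (fmap (simplex m \<alpha>) i j k f)"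
    if "i \<in> objs (path_ccat m)" "j \<in> objs (path_ccat m)"
      "f \<in> cubes (maps (path_ccat m) i j) k" "l \<le> k" for i j k l f
    using that
    by (auto simp: simplex_fmap simplex_fobj path_ccat_maps box_hom_degen level_cube_degen
        through_1_compose split: if_splits intro!: level_cube_cong)
  show "fmap (simplex m \<alpha>) i j (Suc k) (conn (maps (path_ccat m) i j) k l \<epsilon> f) =
      conn (maps Graph (fobj (simplex m \<alpha>) i) (fobj (simplex m \<alpha>) j)) k l \<epsilon> (fmap (simplex m \<alpha>) i j k f)"
    if "i \<in> objs (path_ccat m)" "j \<in> objs (path_ccat m)"
      "f \<in> cubes (maps (path_ccat m) i j) k" "l < k" for i j k l \<epsilon> f
    using that
    by (auto simp: simplex_fmap simplex_fobj path_ccat_maps box_hom_conn level_cube_conn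
        through_1_compose split: if_splits intro!: level_cube_cong)
  show "fmap (simplex m \<alpha>) i i 0 (ident (path_ccat m) i) = ident Graph (fobj (simplex m \<alpha>) i)"
    if "i \<in> objs (path_ccat m)" for i
  proof -
    have "arr (\<alpha> i) (\<alpha> i) c = restrict id (verts (ob (\<alpha> i)))" for c
      by (auto simp: arr_def ob_def)
    then show ?thesis
      using that box_hom_id[of 0] by (simp add: simplex_fmap simplex_fobj level_cube_const[OF refl] level_cube_def)
  qed
  show "fmap (simplex m \<alpha>) i l (a + b) (ccomp (path_ccat m) i j l a b f g) =
      ccomp Graph (fobj (simplex m \<alpha>) i) (fobj (simplex m \<alpha>) j) (fobj (simplex m \<alpha>) l) a b
        (fmap (simplex m \<alpha>) i j a f) (fmap (simplex m \<alpha>) j l b g)"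
    if "i \<in> objs (path_ccat m)" "j \<in> objs (path_ccat m)" "l \<in> objs (path_ccat m)"
      "f \<in> cubes (maps (path_ccat m) i j) a" "g \<in> cubes (maps (path_ccat m) j l) b"
    for i j l a b f g
    using that simplex_comp[OF adm, of i j l f a g b] by (simp add: simplex_fobj split: if_splits)
qed

lemma simplex_cong:
  assumes "\<And>i. i \<le> m \<Longrightarrow> \<alpha> i = \<beta> i"
  shows "simplex m \<alpha> = simplex m \<beta>"
proof -
  have "through_1 \<alpha> i j f = through_1 \<beta> i j f" if "j \<le> m" for i j f
    using assms that by (auto simp: through_1_def fun_eq_iff)
  then show ?thesis using assms unfolding simplex_def by (auto intro!: restrict_ext ext)
qed

text \<open>Restriction only relabels. If the ends have labels \<open>0\<close> and
  \<open>3\<close>, every object labelled \<open>1\<close> lands strictly between their images, so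
  the end points discarded by \<open>path_bits\<close> carry no information; otherwise the arrow is
  independent of the level.\<close>

lemma simplex_act:
  assumes adm: "admissible n \<alpha>" and \<beta>: "\<beta> \<in> simplex_op m n"
  shows "cfun_comp (path_ccat m) (simplex n \<alpha>) (path_cfun m \<beta>) = simplex m (\<alpha> \<circ> \<beta>)"
proof -
  have mono: "\<beta> i \<le> \<beta> j" if "i \<le> j" "j \<le> m" for i j using simplex_op_mono[OF \<beta> that] .
  have le: "\<beta> i \<le> n" if "i \<le> m" for i using simplex_op_le[OF \<beta> that] .
  have pb: "compose (tuples k) (path_bits \<beta> i j) f \<in> box_hom k (\<beta> j - \<beta> i - 1)"
    if "i \<le> j" "j \<le> m" "f \<in> box_hom k (j - i - 1)" for i j k f
    using path_bits_box_hom[of m \<beta> i j f k] that \<beta> by (simp add: simplex_op_def)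
  have eq: "level_cube N k (through_1 \<alpha> (\<beta> i) (\<beta> j) (compose (tuples k) (path_bits \<beta> i j) f))
        (arr (\<alpha> (\<beta> i)) (\<alpha> (\<beta> j))) =
      level_cube N k (through_1 (\<alpha> \<circ> \<beta>) i j f) (arr (\<alpha> (\<beta> i)) (\<alpha> (\<beta> j)))"
    if ij: "i \<le> j" "j \<le> m" "f \<in> box_hom k (j - i - 1)" for i j k f
  proof (cases "\<alpha> (\<beta> i) = 0 \<and> \<alpha> (\<beta> j) = 3")
    case True
    have nth: "path_bits \<beta> i j w ! (p - \<beta> i - 1) = (\<exists>q. i < q \<and> q < j \<and> \<beta> q = p \<and> w ! (q - i - 1))"
      if "\<beta> i < p" "p < \<beta> j" for p w
      using that by (simp add: path_bits_def)
    have between: "\<beta> i < \<beta> q \<and> \<beta> q < \<beta> j" if "i < q" "q < j" "\<alpha> (\<beta> q) = 1" for q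
      using mono[of i q] mono[of q j] that True ij by (auto intro!: le_neq_implies_less)
    have "through_1 \<alpha> (\<beta> i) (\<beta> j) (compose (tuples k) (path_bits \<beta> i j) f) w =
        through_1 (\<alpha> \<circ> \<beta>) i j f w" if "w \<in> tuples k" for w
      unfolding through_1_def compose_eq[OF that] comp_apply using nth between by (metis (no_types, lifting))
    then show ?thesis by (rule level_cube_cong)
  next
    case False
    have "arr (\<alpha> (\<beta> i)) (\<alpha> (\<beta> j)) c = arr (\<alpha> (\<beta> i)) (\<alpha> (\<beta> j)) 0" for c
      using False by (auto simp: arr_def)
    then show ?thesis
      using level_cube_const[of N "arr (\<alpha> (\<beta> i)) (\<alpha> (\<beta> j))" "arr (\<alpha> (\<beta> i)) (\<alpha> (\<beta> j)) 0"] by metis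
  qed
  have "fmap (cfun_comp (path_ccat m) (simplex n \<alpha>) (path_cfun m \<beta>)) i j k f = fmap (simplex m (\<alpha> \<circ> \<beta>)) i j k f"
    for i j k f
  proof (cases "j \<le> m \<and> i \<le> j \<and> f \<in> box_hom k (j - i - 1)")
    case True
    then show ?thesis
      using pb[of i j f k] eq[of i j f k] mono[of i j] le[of j] le[of i]
      by (simp add: cfun_comp_def path_cfun_def simplex_def)
  next
    case False
    then show ?thesis
      by (auto simp: cfun_comp_def simplex_def)
  qed
  moreover have "fobj (cfun_comp (path_ccat m) (simplex n \<alpha>) (path_cfun m \<beta>)) = fobj (simplex m (\<alpha> \<circ> \<beta>))"
    using le by (auto simp: cfun_comp_def simplex_def path_cfun_def compose_def intro!: restrict_ext)
  ultimately show ?thesis by (intro cfun.equality) (auto intro!: ext)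
qed

end

section \<open>Joins and cones\<close>

lemma horn_simps:
  "x \<in> simps (horn n k) m \<longleftrightarrow> x \<in> simplex_op m n \<and> (\<exists>j\<le>n. j \<noteq> k \<and> j \<notin> x ` {..m})"
  "sact (horn n k) l m \<alpha> x = compose {..l} x \<alpha>"
  by (simp_all add: horn_def std_simplex_def)

lemma std_simplex_simps:
  "simps (std_simplex n) m = simplex_op m n"
  "sact (std_simplex n) l m \<alpha> x = compose {..l} x \<alpha>"
  by (simp_all add: std_simplex_def)

lemma boundary_simps:
  "x \<in> simps (boundary n) m \<longleftrightarrow> x \<in> simplex_op m n \<and> (\<exists>j\<le>n. j \<notin> x ` {..m})"
  "sact (boundary n) l m \<alpha> x = compose {..l} x \<alpha>"
  by (simp_all add: boundary_def std_simplex_def)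

lemma simplex_op_compose:
  assumes "\<alpha> \<in> simplex_op l m" and "x \<in> simplex_op m n"
  shows "compose {..l} x \<alpha> \<in> simplex_op l n"
  using assms simplex_op_mono[OF assms(1)] simplex_op_mono[OF assms(2)]
    simplex_op_le[OF assms(1)] simplex_op_le[OF assms(2)]
  by (auto simp: simplex_op_def[of l n] compose_def intro!: mono_onI)

lemma horn_act_closed:
  assumes "\<alpha> \<in> simplex_op l m" and "x \<in> simps (horn n k) m"
  shows "sact (horn n k) l m \<alpha> x \<in> simps (horn n k) l"
proof -
  have "compose {..l} x \<alpha> ` {..l} \<subseteq> x ` {..m}"
    using simplex_op_le[OF assms(1)] by (auto simp: compose_def)
  then show ?thesis
    using assms simplex_op_compose[of \<alpha> l m x n] unfolding horn_simps by blast
qed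

lemma const_simplex_op [simp]: "k \<le> n \<Longrightarrow> (\<lambda>i\<in>{..m}. k) \<in> simplex_op m n"
  by (simp add: simplex_op_def mono_on_def)

lemma simplex_op_0: "y \<in> simplex_op m 0 \<Longrightarrow> y = (\<lambda>i\<in>{..m}. 0)"
  by (auto simp: simplex_op_def PiE_iff extensional_def fun_eq_iff)

lemma card_initial_segment:
  fixes p :: nat
  assumes \<alpha>: "\<alpha> \<in> simplex_op m n" and c_def: "c = card {i. i \<le> m \<and> \<alpha> i \<le> p}"
  shows "c \<le> Suc m" and "i \<le> m \<Longrightarrow> \<alpha> i \<le> p \<longleftrightarrow> i < c"
proof -
  let ?S = "{i. i \<le> m \<and> \<alpha> i \<le> p}"
  have "?S \<subseteq> {..m}" by auto
  then have fin: "finite ?S" by (rule finite_subset) simp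
  have S: "?S = {..<c}"
  proof (cases "?S = {}")
    case True
    then have "c = 0" by (metis c_def card.empty)
    then show ?thesis using True by simp
  next
    case False
    have "Max ?S \<in> ?S" using Max_in[OF fin False] .
    then have "?S = {..Max ?S}"
      using Max_ge[OF fin] simplex_op_mono[OF \<alpha>, of _ "Max ?S"] by (fastforce intro: order_trans)
    then have "c = Suc (Max ?S)" using card_atMost[of "Max ?S"] by (simp only: c_def)
    then show ?thesis using \<open>?S = {..Max ?S}\<close> by (simp only: lessThan_Suc_atMost)
  qed
  show "c \<le> Suc m" using card_mono[OF _ \<open>?S \<subseteq> {..m}\<close>] by (simp add: c_def)
  show "i \<le> m \<Longrightarrow> \<alpha> i \<le> p \<longleftrightarrow> i < c" using S by auto
qed

lemma join_simpsE:
  assumes "z \<in> simps (join X Y) n"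
  obtains (left) x where "z = JLeft x" "x \<in> simps X n"
    | (right) y where "z = JRight y" "y \<in> simps Y n"
    | (both) p q x y where "z = JBoth p q x y" "p + 1 + q = n" "x \<in> simps X p" "y \<in> simps Y q"
  using assms by (auto simp: join_def)

lemma join_simpsI:
  "x \<in> simps X n \<Longrightarrow> JLeft x \<in> simps (join X Y) n"
  "y \<in> simps Y n \<Longrightarrow> JRight y \<in> simps (join X Y) n"
  "p + 1 + q = n \<Longrightarrow> x \<in> simps X p \<Longrightarrow> y \<in> simps Y q \<Longrightarrow> JBoth p q x y \<in> simps (join X Y) n"
  by (auto simp: join_def)

lemma join_act_left: "sact (join X Y) m n \<alpha> (JLeft x) = JLeft (sact X m n \<alpha> x)"
  by (simp add: join_def)

lemma join_act_right: "sact (join X Y) m n \<alpha> (JRight y) = JRight (sact Y m n \<alpha> y)"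
  by (simp add: join_def)

lemma join_act_both_left:
  assumes "\<And>i. i \<le> m \<Longrightarrow> \<alpha> i \<le> p"
  shows "sact (join X Y) m n \<alpha> (JBoth p q x y) = JLeft (sact X m p \<alpha> x)"
proof -
  have "{i. i \<le> m \<and> \<alpha> i \<le> p} = {..m}" using assms by auto
  then show ?thesis by (simp add: join_def)
qed

lemma join_act_both_right:
  assumes "\<And>i. i \<le> m \<Longrightarrow> p < \<alpha> i"
  shows "sact (join X Y) m n \<alpha> (JBoth p q x y) = JRight (sact Y m q (\<lambda>i\<in>{..m}. \<alpha> i - Suc p) y)"
proof -
  have "\<not> \<alpha> i \<le> p" if "i \<le> m" for i using assms[OF that] by simp
  then show ?thesis by (simp add: join_def cong: conj_cong)
qed

lemma join_act_both_both:
  assumes "r < m" and "\<And>i. i \<le> m \<Longrightarrow> \<alpha> i \<le> p \<longleftrightarrow> i \<le> r"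
  shows "sact (join X Y) m n \<alpha> (JBoth p q x y) =
    JBoth r (m - Suc r) (sact X r p (restrict \<alpha> {..r}) x)
      (sact Y (m - Suc r) q (\<lambda>i\<in>{..m - Suc r}. \<alpha> (Suc (i + r)) - Suc p) y)"
proof -
  have "{i. i \<le> m \<and> \<alpha> i \<le> p} = {..r}" using assms by auto
  then show ?thesis using assms(1) by (simp add: join_def)
qed

lemma simplex_op_join_cases:
  assumes \<alpha>: "\<alpha> \<in> simplex_op m n" and n: "p + 1 + q = n"
  obtains (left) "\<And>i. i \<le> m \<Longrightarrow> \<alpha> i \<le> p" "\<alpha> \<in> simplex_op m p"
    | (right) "\<And>i. i \<le> m \<Longrightarrow> p < \<alpha> i" "(\<lambda>i\<in>{..m}. \<alpha> i - Suc p) \<in> simplex_op m q"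
    | (both) r where "r < m" "\<And>i. i \<le> m \<Longrightarrow> \<alpha> i \<le> p \<longleftrightarrow> i \<le> r"
      "restrict \<alpha> {..r} \<in> simplex_op r p"
      "(\<lambda>i\<in>{..m - Suc r}. \<alpha> (Suc (i + r)) - Suc p) \<in> simplex_op (m - Suc r) q"
proof -
  define c where "c = card {i. i \<le> m \<and> \<alpha> i \<le> p}"
  have c: "c \<le> Suc m" "\<And>i. i \<le> m \<Longrightarrow> \<alpha> i \<le> p \<longleftrightarrow> i < c"
    using card_initial_segment[OF \<alpha> c_def] by blast+
  note mono = simplex_op_mono[OF \<alpha>]
  have le: "\<alpha> i - Suc p \<le> q" if "i \<le> m" for i
    using simplex_op_le[OF \<alpha> that] n by linarith
  consider "c = Suc m" | "c = 0" | r where "c = Suc r" "r < m"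
    using c(1) by (cases c) (auto simp: le_Suc_eq)
  then show ?thesis
  proof cases
    case 1
    show ?thesis
    proof (rule left)
      show "\<alpha> \<in> simplex_op m p"
        using \<alpha> c 1 by (auto simp: simplex_op_def PiE_iff)
    qed (use c 1 in auto)
  next
    case 2
    show ?thesis
    proof (rule right)
      show "(\<lambda>i\<in>{..m}. \<alpha> i - Suc p) \<in> simplex_op m q"
        using mono le by (auto simp: simplex_op_def intro!: mono_onI diff_le_mono)
    qed (use c 2 in \<open>auto simp flip: not_le\<close>)
  next
    case (3 r)
    show ?thesis
    proof (rule both)
      show "r < m" by fact
      show "\<alpha> i \<le> p \<longleftrightarrow> i \<le> r" if "i \<le> m" for i
        using c(2)[OF that] 3 by auto
      show "restrict \<alpha> {..r} \<in> simplex_op r p"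
        using c(2) 3 mono by (auto simp: simplex_op_def intro!: mono_onI)
      show "(\<lambda>i\<in>{..m - Suc r}. \<alpha> (Suc (i + r)) - Suc p) \<in> simplex_op (m - Suc r) q"
        using mono le \<open>r < m\<close> by (auto simp: simplex_op_def intro!: mono_onI diff_le_mono)
    qed
  qed
qed

section \<open>Colimit cones map to every cone\<close>

lemma vertex_map_act:
  assumes "\<alpha> \<in> simplex_op m n"
  shows "vertex_map k m (compose {..m} y \<alpha>) = compose {..m} (vertex_map k n y) \<alpha>"
  using simplex_op_le[OF assms] by (auto simp: vertex_map_def compose_def intro!: restrict_ext)

lemma simplicial_mapD:
  assumes "simplicial_map X Y f"
  shows "x \<in> simps X n \<Longrightarrow> f n x \<in> simps Y n"
    and "\<alpha> \<in> simplex_op m n \<Longrightarrow> x \<in> simps X n \<Longrightarrow> sact Y m n \<alpha> (f n x) = f m (sact X m n \<alpha> x)"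
  using assms by (simp_all add: simplicial_map_def)

lemma compose_at_0: "compose {..m::nat} f g 0 = f (g 0)"
  by (simp add: compose_def)

text \<open>A colimit is in particular weakly initial: a cone map is a map out of \<open>K \<star> \<Delta>\<^sup>1\<close>, and
  \<open>K \<star> \<partial>\<Delta>\<^sup>1\<close> consists of two copies of \<open>K \<star> \<Delta>\<^sup>0\<close> glued along \<open>K\<close>.\<close>

lemma colimit_cone_map:
  fixes K :: "'k sset" and S :: "'s sset"
  assumes K: "\<And>m n \<alpha> x. \<alpha> \<in> simplex_op m n \<Longrightarrow> x \<in> simps K n \<Longrightarrow> sact K m n \<alpha> x \<in> simps K m"
    and colim: "is_colimit K S D c" and cone': "is_cone K S D c'"
  shows "\<exists>h. is_cone_map K S c c' h"
proof -
  let ?B = "join K (boundary 1)" and ?P = "join K (std_simplex 0)"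
  define proj :: "nat \<Rightarrow> ('k, nat \<Rightarrow> nat) join_simplex \<Rightarrow> ('k, nat \<Rightarrow> nat) join_simplex"
    where "proj = join_map (\<lambda>_ x. x) (vertex_map 0)"
  \<comment> \<open>Chooses between the two copies of the cone point. Simplices of
    \<open>boundary 1\<close> are constant (fact \<open>const\<close> below), so their vertex
    \<open>0\<close> decides; on \<open>K\<close> both cones agree.\<close>
  define top :: "('k, nat \<Rightarrow> nat) join_simplex \<Rightarrow> bool"
    where "top z = (case z of JLeft _ \<Rightarrow> False | JRight y \<Rightarrow> y 0 = 1 | JBoth _ _ _ y \<Rightarrow> y 0 = 1)" for z
  define b where "b n z = (if top z then c' n (proj n z) else c n (proj n z))" for n z
  have cone: "is_cone K S D c" using colim by (simp add: is_colimit_def)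
  have map: "simplicial_map ?P S c" "simplicial_map ?P S c'"
    using cone cone' by (simp_all add: is_cone_def)
  have agree: "c n (JLeft x) = c' n (JLeft x)" if "x \<in> simps K n" for n x
    using cone cone' that by (simp add: is_cone_def)
  have proj_mem: "proj n z \<in> simps ?P n" if "z \<in> simps ?B n" for n z
    using that by (cases rule: join_simpsE)
      (auto simp: proj_def join_map_def vertex_map_def std_simplex_simps intro!: join_simpsI)
  have const: "y i = y 0" if y: "y \<in> simps (boundary 1) n" and "i \<le> n" for y i n
  proof -
    obtain j where "j \<le> 1" "j \<notin> y ` {..n}" "y \<in> simplex_op n 1"
      using y unfolding boundary_simps by blast
    then have "y i \<noteq> j" "y 0 \<noteq> j" "y i \<le> 1" "y 0 \<le> 1"
      using \<open>i \<le> n\<close> simplex_op_le[of y n 1] by auto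
    then show ?thesis using \<open>j \<le> 1\<close> by linarith
  qed
  have act: "b m (sact ?B m n \<alpha> z) = sact S m n \<alpha> (b n z)"
    if \<alpha>: "\<alpha> \<in> simplex_op m n" and z: "z \<in> simps ?B n" for m n \<alpha> z
  proof -
    have S: "sact S m n \<alpha> (b n z) = (if top z then c' m (sact ?P m n \<alpha> (proj n z)) else c m (sact ?P m n \<alpha> (proj n z)))"
      unfolding b_def using simplicial_mapD(2)[OF map(1) \<alpha> proj_mem[OF z]]
        simplicial_mapD(2)[OF map(2) \<alpha> proj_mem[OF z]] by simp
    \<comment> \<open>An operator changes \<open>top\<close> only by landing in \<open>K\<close>,
      where both cones restrict to \<open>D\<close>.\<close>
    have "proj m (sact ?B m n \<alpha> z) = sact ?P m n \<alpha> (proj n z) \<and>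
        (top (sact ?B m n \<alpha> z) = top z \<or> (\<exists>x \<in> simps K m. proj m (sact ?B m n \<alpha> z) = JLeft x))"
      using z
    proof (cases rule: join_simpsE)
      case (left x)
      then show ?thesis by (simp add: proj_def join_map_def top_def join_act_left)
    next
      case (right y)
      then show ?thesis
        using const[of y n "\<alpha> 0"] simplex_op_le[OF \<alpha>, of 0]
        by (simp add: proj_def join_map_def top_def join_act_right boundary_simps std_simplex_simps
            vertex_map_act[OF \<alpha>] compose_at_0)
    next
      case (both p q x y)
      from \<alpha> both(2) show ?thesis
      proof (cases rule: simplex_op_join_cases)
        case left
        then show ?thesis using K both(3) by (simp add: both(1) join_act_both_left proj_def join_map_def)
      next
        case right
        have "\<alpha> 0 - Suc p \<le> q" using simplex_op_le[OF right(2), of 0] by simp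
        then show ?thesis
          using const[OF both(4), of "\<alpha> 0 - Suc p"]
          by (simp add: both(1) join_act_both_right[OF right(1)] proj_def join_map_def top_def boundary_simps std_simplex_simps
              vertex_map_act[OF right(2)] compose_at_0)
      next
        case (both r)
        have "\<alpha> (Suc r) - Suc p \<le> q" using simplex_op_le[OF both(4), of 0] by simp
        then show ?thesis
          using const[OF \<open>y \<in> simps (boundary 1) q\<close>, of "\<alpha> (Suc r) - Suc p"]
          by (simp add: \<open>z = _\<close> join_act_both_both[OF both(1,2)] proj_def join_map_def top_def boundary_simps std_simplex_simps
              vertex_map_act[OF both(4)] compose_at_0)
      qed
    qed
    then have p: "proj m (sact ?B m n \<alpha> z) = sact ?P m n \<alpha> (proj n z)"
      and "top (sact ?B m n \<alpha> z) = top z \<or> (\<exists>x \<in> simps K m. proj m (sact ?B m n \<alpha> z) = JLeft x)"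
      by blast+
    then consider "top (sact ?B m n \<alpha> z) = top z"
      | x where "x \<in> simps K m" "proj m (sact ?B m n \<alpha> z) = JLeft x" by blast
    then show ?thesis
    proof cases
      case 1
      then show ?thesis unfolding S unfolding b_def p by simp
    next
      case 2
      then show ?thesis using agree[OF 2(1)] unfolding S unfolding b_def p by simp
    qed
  qed
  have b: "simplicial_map ?B S b"
  proof -
    have "b n z \<in> simps S n" if "z \<in> simps ?B n" for n z
      unfolding b_def using simplicial_mapD(1)[OF map(1) proj_mem[OF that]]
        simplicial_mapD(1)[OF map(2) proj_mem[OF that]] by simp
    then show ?thesis using act unfolding simplicial_map_def by blast
  qed
  have incl: "join_map (\<lambda>_ x. x) (vertex_map k) n z \<in> simps ?B n"
    and proj_incl: "proj n (join_map (\<lambda>_ x. x) (vertex_map k) n z) = z"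
    if "z \<in> simps ?P n" "k \<le> 1" for k n z
  proof -
    have "1 - k \<noteq> k" using that(2) by presburger
    then have 1: "vertex_map k m y \<in> simps (boundary 1) m" for m y
      using that(2) by (auto simp: vertex_map_def boundary_simps intro!: exI[of _ "1 - k"])
    have 2: "vertex_map 0 m (vertex_map k m y) = y" if "y \<in> simps (std_simplex 0) m" for m y
      using that simplex_op_0 by (auto simp: std_simplex_simps vertex_map_def)
    show "join_map (\<lambda>_ x. x) (vertex_map k) n z \<in> simps ?B n"
      using that(1) by (cases rule: join_simpsE) (auto simp: join_map_def 1[simplified] intro!: join_simpsI)
    show "proj n (join_map (\<lambda>_ x. x) (vertex_map k) n z) = z"
      using that(1) by (cases rule: join_simpsE) (auto simp: join_map_def proj_def 2)
  qed
  have b0: "b n (join_map (\<lambda>_ x. x) (vertex_map 0) n z) = c n z" if "z \<in> simps ?P n" for n z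
  proof -
    have "\<not> top (join_map (\<lambda>_ x. x) (vertex_map 0) n z)"
      by (cases z) (auto simp: join_map_def top_def vertex_map_def)
    then show ?thesis using proj_incl[OF that] by (simp add: b_def)
  qed
  have b1: "b n (join_map (\<lambda>_ x. x) (vertex_map 1) n z) = c' n z" if z: "z \<in> simps ?P n" for n z
  proof (cases "\<exists>x. z = JLeft x")
    case True
    then obtain x where "z = JLeft x" "x \<in> simps K n" using z by (auto elim: join_simpsE)
    then show ?thesis using agree proj_incl[OF z, of 1] by (simp add: b_def)
  next
    case False
    then have "top (join_map (\<lambda>_ x. x) (vertex_map 1) n z)"
      by (cases z) (auto simp: join_map_def top_def vertex_map_def)
    then show ?thesis using proj_incl[OF z] by (simp add: b_def)
  qed
  obtain h where h: "simplicial_map (join K (std_simplex 1)) S h" "\<And>m z. z \<in> simps ?B m \<Longrightarrow> h m z = b m z"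
    using colim[unfolded is_colimit_def, THEN conjunct2, rule_format, of 1 b] b b0 by auto
  have "is_cone_map K S c c' h"
    unfolding is_cone_map_def using h incl b0 b1 by simp
  then show ?thesis by blast
qed

section \<open>The loop cone as a simplicial map out of the join\<close>

lemma cfun_eqI: "fobj F = fobj H \<Longrightarrow> fmap F = fmap H \<Longrightarrow> F = (H :: ('o, 'c, 'p, 'd) cfun)"
  by (rule cfun.equality) simp_all

lemma degen_iter_const:
  "degen_iter (graph_nerve G) k (\<lambda>v\<in>tuples 0. y) = (\<lambda>v\<in>tuples k. y)"
proof (induction k)
  case (Suc k)
  then show ?case
    by (auto simp: graph_nerve_def compose_def del_coord_tuples intro!: restrict_ext)
qed simp

text \<open>Vertices of the horn keep their number and every vertex of the second factor gets the
  label \<open>3\<close> of the tip. Arguments beyond the dimension have no meaning, so labels are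
  compared vertex by vertex and \<open>simplex_cong\<close> does the rest.\<close>

definition join_label :: "(nat \<Rightarrow> nat, 't) join_simplex \<Rightarrow> nat \<Rightarrow> nat" where
  "join_label z =
     (case z of JLeft x \<Rightarrow> x | JRight _ \<Rightarrow> (\<lambda>_. 3) | JBoth p _ x _ \<Rightarrow> (\<lambda>i. if i \<le> p then x i else 3))"

lemma join_label_act:
  assumes \<alpha>: "\<alpha> \<in> simplex_op m n" and z: "z \<in> simps (join (horn 2 0) Y) n" and "i \<le> m"
  shows "join_label (sact (join (horn 2 0) Y) m n \<alpha> z) i = join_label z (\<alpha> i)"
  using z
proof (cases rule: join_simpsE)
  case (both p q x y)
  from \<alpha> both(2) show ?thesis
  proof (cases rule: simplex_op_join_cases)
    case left
    then show ?thesis using \<open>i \<le> m\<close> by (simp add: both(1) join_act_both_left join_label_def horn_simps compose_def)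
  next
    case right
    have "\<not> \<alpha> i \<le> p" using right(1)[OF \<open>i \<le> m\<close>] by simp
    then show ?thesis by (simp add: both(1) join_act_both_right[OF right(1)] join_label_def)
  next
    case (both r)
    then show ?thesis using both(2)[of i] \<open>i \<le> m\<close>
      by (simp add: \<open>z = _\<close> join_act_both_both[OF both(1,2)] join_label_def horn_simps compose_def)
  qed
qed (use \<open>i \<le> m\<close> in \<open>auto simp: join_act_left join_act_right join_label_def horn_simps compose_def\<close>)

context loop_cone
begin

lemma admissible_horn: "x \<in> simps (horn 2 0) n \<Longrightarrow> admissible n x"
proof -
  assume "x \<in> simps (horn 2 0) n"
  then obtain j where x: "x \<in> simplex_op n 2" and j: "j = 1 \<or> j = 2" "j \<notin> x ` {..n}"
    unfolding horn_simps by (metis One_nat_def Suc_1 le_SucE le_zero_eq)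
  have "\<not> (\<exists>i\<le>n. \<exists>k\<le>n. x i = 1 \<and> x k = 2)" using j by force
  moreover have "\<forall>i\<le>n. x i \<le> 3" using simplex_op_le[OF x] by force
  ultimately show "admissible n x" using x by (simp add: admissible_def simplex_op_def)
qed

lemma admissible_join_label:
  assumes "z \<in> simps (join (horn 2 0) Y) n"
  shows "admissible n (join_label z)"
  using assms
proof (cases rule: join_simpsE)
  case (left x)
  then show ?thesis using admissible_horn by (simp add: join_label_def)
next
  case (right y)
  then show ?thesis by (simp add: join_label_def admissible_def mono_on_def)
next
  case (both p q x y)
  have adm: "admissible p x" using admissible_horn[OF both(3)] .
  have "mono_on {..n} (join_label z)"
    using admissible_mono[OF adm] adm
    by (auto simp: both(1) join_label_def admissible_def intro!: mono_onI)
  then show ?thesis using adm by (auto simp: both(1) join_label_def admissible_def)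
qed

lemma graph_edge_eq: "graph_edge J I u = simplex 1 (\<lambda>i. i)"
proof (rule cfun_eqI)
  show "fobj (graph_edge J I u) = fobj (simplex 1 (\<lambda>i. i))"
    by (auto simp: graph_edge_def hc_edge_def simplex_def ob_def intro!: restrict_ext)
  have "fmap (graph_edge J I u) i j k f = fmap (simplex 1 (\<lambda>i. i)) i j k f" for i j k f
  proof (cases "j \<le> 1 \<and> i \<le> j \<and> f \<in> box_hom k (j - i - 1)")
    case True
    have "arr 0 1 c = u" "arr i i c = restrict id (verts (ob i))" for c
      by (auto simp: arr_def ob_def)
    then have lc: "level_cube N k b (arr 0 1) = (\<lambda>v\<in>tuples k. u)"
      "level_cube N k b (arr i i) = (\<lambda>v\<in>tuples k. restrict id (verts (ob i)))" for b
      by (simp_all add: level_cube_def)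
    have "i = 0 \<and> j = 1 \<or> j = i" using True by linarith
    then show ?thesis
    proof
      assume "i = 0 \<and> j = 1"
      then show ?thesis using True lc(1)
        by (simp add: graph_edge_def hc_edge_def simplex_def degen_iter_const del: tuples_0)
    next
      assume "j = i"
      then show ?thesis using True lc(2)
        by (auto simp add: graph_edge_def hc_edge_def simplex_def degen_iter_const ob_def Let_def
            simp del: tuples_0)
    qed
  next
    case False
    then show ?thesis by (auto simp: graph_edge_def hc_edge_def simplex_def)
  qed
  then show "fmap (graph_edge J I u) = fmap (simplex 1 (\<lambda>i. i))" by (simp add: fun_eq_iff)
qed

text \<open>Both legs of the span are the same edge, so \<open>min 1\<close> folds label
  \<open>2\<close> onto \<open>1\<close>: the two carry the same object and the same arrows, and the
  loop is not seen before label \<open>3\<close>.\<close>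

lemma horn_span_eq:
  assumes x: "x \<in> simps (horn 2 0) n"
  shows "horn_span NGraph (graph_edge J I u) (graph_edge J I u) n x = simplex n x"
proof -
  have op: "x \<in> simplex_op n 2" using x by (simp add: horn_simps)
  let ?y = "\<lambda>i\<in>{..n}. min 1 (x i)"
  have y: "?y \<in> simplex_op n 1"
    using min.mono[OF order_refl simplex_op_mono[OF op], of _ _ 1]
    by (simp add: simplex_op_def mono_on_def)
  have adm: "admissible 1 (\<lambda>i. i)" by (simp add: admissible_def mono_on_def)
  have "horn_span NGraph (graph_edge J I u) (graph_edge J I u) n x = simplex n ((\<lambda>i. i) \<circ> ?y)"
    using simplex_act[OF adm y] by (simp add: horn_span_def NGraph_def hc_nerve_def graph_edge_eq)
  also have "\<dots> = simplex n x"
  proof (rule cfun_eqI)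
    have x2: "x i \<le> 2" if "i \<le> n" for i using simplex_op_le[OF op that] .
    then have ob: "ob (min 1 (x i)) = ob (x i)" if "i \<le> n" for i
      using that by (force simp: ob_def min_def)
    then show "fobj (simplex n ((\<lambda>i. i) \<circ> ?y)) = fobj (simplex n x)"
      by (auto simp: simplex_def intro!: restrict_ext)
    have arr: "arr (min 1 (x i)) (min 1 (x j)) c = arr (x i) (x j) d" if "i \<le> n" "j \<le> n" for i j c d
      using x2[OF that(1)] x2[OF that(2)] ob[OF that(1)] by (auto simp: arr_def min_def ob_def)
    then have "level_cube N k (through_1 ((\<lambda>i. i) \<circ> ?y) i j f) (arr (min 1 (x i)) (min 1 (x j))) =
        level_cube N k (through_1 x i j f) (arr (x i) (x j))"
      if "i \<le> n" "j \<le> n" for i j k f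
      using that unfolding level_cube_def by (intro restrict_ext) blast
    then show "fmap (simplex n ((\<lambda>i. i) \<circ> ?y)) = fmap (simplex n x)"
      by (auto simp: simplex_def intro!: ext)
  qed
  finally show ?thesis .
qed

lemma is_cone_simplex:
  "is_cone (horn 2 0) NGraph (horn_span NGraph (graph_edge J I u) (graph_edge J I u))
     (\<lambda>n z. simplex n (join_label z))"
proof -
  have "sact NGraph m n \<alpha> (simplex n (join_label z)) =
      simplex m (join_label (sact (join (horn 2 0) (std_simplex 0)) m n \<alpha> z))"
    if "\<alpha> \<in> simplex_op m n" "z \<in> simps (join (horn 2 0) (std_simplex 0)) n" for m n \<alpha> z
    using simplex_act[OF admissible_join_label[OF that(2)] that(1)] join_label_act[OF that]
    by (simp add: NGraph_def hc_nerve_def) (intro simplex_cong, simp)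
  moreover have "simplex n (join_label z) \<in> simps NGraph n"
    if "z \<in> simps (join (horn 2 0) (std_simplex 0)) n" for n z
    using simplex_functor[OF admissible_join_label[OF that]] by (simp add: NGraph_def hc_nerve_def)
  ultimately show ?thesis
    by (simp add: is_cone_def simplicial_map_def horn_span_eq join_label_def)
qed

end

section \<open>Winding numbers\<close>

text \<open>The sum takes the \<open>2 * M\<close> unit steps from \<open>- M\<close> to
  \<open>M\<close>. A cube rests outside a window of its own; statements about cubes are made for
  all large \<open>M\<close>, so that several cubes can share one window.\<close>

definition wind :: "('a \<Rightarrow> 'a \<Rightarrow> int) \<Rightarrow> nat \<Rightarrow> (int \<Rightarrow> 'a) \<Rightarrow> int" where
  "wind \<omega> M p = (\<Sum>i<2 * M. \<omega> (p (int i - int M)) (p (int i - int M + 1)))"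

text \<open>A cochain that is closed on squares. When the edge relation is reflexive this includes
  triangles and backtracking, so sums along paths respect A-homotopy; the bound by \<open>1\<close>
  turns lengths into bounds on winding numbers.\<close>

locale cocycle =
  fixes G :: "'v graph" and \<omega> :: "'v \<Rightarrow> 'v \<Rightarrow> int"
  assumes square: "\<lbrakk>(a, b) \<in> edges G; (b, c) \<in> edges G; (a, d) \<in> edges G; (d, c) \<in> edges G\<rbrakk> \<Longrightarrow>
      \<omega> a b + \<omega> b c = \<omega> a d + \<omega> d c"
    and refl_0: "\<omega> a a = 0"
    and abs_le_1: "\<bar>\<omega> a b\<bar> \<le> 1"
begin

text \<open>A discrete Green formula: neighbouring unit squares share a side, so
  \<open>square\<close> telescopes along each row and then over the rows.\<close>

lemma rectangle:
  fixes s :: "nat \<Rightarrow> nat \<Rightarrow> 'v"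
  assumes h: "\<And>i j. (s i j, s (Suc i) j) \<in> edges G" and v: "\<And>i j. (s i j, s i (Suc j)) \<in> edges G"
  shows "(\<Sum>i<a. \<omega> (s i 0) (s (Suc i) 0)) + (\<Sum>j<b. \<omega> (s a j) (s a (Suc j))) =
    (\<Sum>j<b. \<omega> (s 0 j) (s 0 (Suc j))) + (\<Sum>i<a. \<omega> (s i b) (s (Suc i) b))"
proof (induction b)
  case (Suc b)
  have "(\<Sum>i<a. \<omega> (s i b) (s (Suc i) b)) + \<omega> (s a b) (s a (Suc b)) =
      \<omega> (s 0 b) (s 0 (Suc b)) + (\<Sum>i<a. \<omega> (s i (Suc b)) (s (Suc i) (Suc b)))"
  proof (induction a)
    case (Suc a)
    then show ?case
      using square[OF h v v h, of a b] by simp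
  qed simp
  then show ?case using Suc by simp
qed simp

lemma wind_square:
  fixes s :: "int \<Rightarrow> int \<Rightarrow> 'v"
  assumes "\<And>x y. (s x y, s (x + 1) y) \<in> edges G" and "\<And>x y. (s x y, s x (y + 1)) \<in> edges G"
  shows "wind \<omega> M (\<lambda>x. s x (- int M)) + wind \<omega> M (\<lambda>y. s (int M) y) =
    wind \<omega> M (\<lambda>y. s (- int M) y) + wind \<omega> M (\<lambda>x. s x (int M))"
proof -
  define s' where "s' i j = s (int i - int M) (int j - int M)" for i j
  have "(s' i j, s' (Suc i) j) \<in> edges G" "(s' i j, s' i (Suc j)) \<in> edges G" for i j
    using assms(1)[of "int i - int M" "int j - int M"] assms(2)[of "int i - int M" "int j - int M"]
    by (simp_all add: s'_def algebra_simps)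
  from rectangle[of s' "2 * M" "2 * M", OF this] show ?thesis
    by (simp add: wind_def s'_def algebra_simps)
qed

text \<open>At most \<open>2 * K\<close> steps move, however large \<open>M\<close> is, and each
  contributes at most \<open>1\<close> in absolute value.\<close>

lemma wind_bounded:
  assumes "\<And>y. y \<ge> int K \<Longrightarrow> p y = p (int K)" and "\<And>y. y \<le> - int K \<Longrightarrow> p y = p (- int K)"
  shows "\<bar>wind \<omega> M p\<bar> \<le> 2 * int K"
proof -
  let ?A = "{i. i < 2 * M \<and> - int K \<le> int i - int M \<and> int i - int M < int K}"
  have "\<bar>wind \<omega> M p\<bar> \<le> (\<Sum>i<2 * M. \<bar>\<omega> (p (int i - int M)) (p (int i - int M + 1))\<bar>)"
    unfolding wind_def by (rule sum_abs)
  also have "\<dots> \<le> (\<Sum>i<2 * M. if i \<in> ?A then 1 else 0)"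
  proof (rule sum_mono)
    fix i
    let ?y = "int i - int M"
    assume "i \<in> {..<2 * M}"
    then consider "i \<in> ?A" | "?y \<ge> int K" | "?y + 1 \<le> - int K" by force
    then show "\<bar>\<omega> (p ?y) (p (?y + 1))\<bar> \<le> (if i \<in> ?A then 1 else 0)"
    proof cases
      case 1
      then show ?thesis using abs_le_1 by simp
    next
      case 2
      then have "p ?y = p (?y + 1)" using assms(1)[of ?y] assms(1)[of "?y + 1"] by simp
      then show ?thesis by (simp add: refl_0)
    next
      case 3
      then have "p ?y = p (?y + 1)" using assms(2)[of ?y] assms(2)[of "?y + 1"] by simp
      then show ?thesis by (simp add: refl_0)
    qed
  qed
  also have "\<dots> = int (card ?A)"
    by (simp add: sum.If_cases Int_def)
  also have "card ?A \<le> card {- int K..<int K}"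
    by (rule card_inj_on_le[of "\<lambda>i. int i - int M"]) (auto simp: inj_on_def)
  finally show ?thesis by simp
qed

lemma wind_const: "(\<And>y. p y = p 0) \<Longrightarrow> wind \<omega> M p = 0"
  using wind_bounded[of 0 p M] by (metis abs_le_zero_iff mult_zero_right of_nat_0)

end

section \<open>Sides of a square in the nerve of a graph\<close>

lemma face_eventually:
  assumes f: "f \<in> cubes (graph_nerve H) (Suc n)" and "i \<le> n"
  shows "\<exists>K. \<forall>M\<ge>K. \<forall>w\<in>tuples n.
    face (graph_nerve H) n i \<epsilon> f w = f (ins_coord i (sign \<epsilon> * int M) w)"
proof -
  \<comment> \<open>\<open>stable\<close> gives one bound for all tuples, so the face is a slice at
    every large \<open>M\<close>, uniformly in \<open>w\<close>.\<close>
  have "stable (Suc n) i \<epsilon> f" using f \<open>i \<le> n\<close> by (simp add: graph_nerve_def)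
  then obtain K where K: "K \<ge> 0"
      "\<forall>v\<in>tuples (Suc n). \<forall>a\<ge>K. f (v[i := sign \<epsilon> * a]) = f (v[i := sign \<epsilon> * K])"
    unfolding stable_def by (elim exE conjE)
  have eq: "f (ins_coord i (sign \<epsilon> * a) w) = f (ins_coord i (sign \<epsilon> * K) w)"
    if "w \<in> tuples n" "a \<ge> K" for w a
    \<comment> \<open>The inserted \<open>0\<close> is a placeholder that the list update in
      \<open>stable\<close> overwrites.\<close>
    using K(2)[rule_format, OF ins_coord_tuples[OF that(1) \<open>i \<le> n\<close>, of 0] that(2)] that(1) \<open>i \<le> n\<close>
    by (simp only: ins_coord_update tuples_def mem_Collect_eq)
  have "face (graph_nerve H) n i \<epsilon> f w = f (ins_coord i (sign \<epsilon> * int M) w)"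
    if "M \<ge> nat K" "w \<in> tuples n" for M w
  proof (rule face_graph_nerve_eqI[OF that(2) K(1)])
    fix a assume "a \<ge> K"
    then show "f (ins_coord i (sign \<epsilon> * a) w) = f (ins_coord i (sign \<epsilon> * int M) w)"
      using eq[OF that(2), of a] eq[OF that(2), of "int M"] that(1) by (metis nat_le_iff)
  qed
  then show ?thesis by blast
qed

lemma cube_1_bounded:
  assumes f: "f \<in> cubes (graph_nerve H) (Suc 0)"
  shows "\<exists>K. \<forall>K'\<ge>K. (\<forall>y\<ge>int K'. f [y] = f [int K']) \<and> (\<forall>y\<le>- int K'. f [y] = f [- int K'])"
proof -
  have "\<exists>K\<ge>0. \<forall>a\<ge>K. f [sign \<epsilon> * a] = f [sign \<epsilon> * K]" for \<epsilon>
  proof -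
    have "stable (Suc 0) 0 \<epsilon> f" using f by (simp add: graph_nerve_def)
    then obtain K where "K \<ge> 0" "\<forall>v\<in>tuples (Suc 0). \<forall>a\<ge>K. f (v[0 := sign \<epsilon> * a]) = f (v[0 := sign \<epsilon> * K])"
      unfolding stable_def by blast
    moreover have "[0] \<in> tuples (Suc 0)" by (simp add: tuples_def)
    ultimately have "\<forall>a\<ge>K. f ([0][0 := sign \<epsilon> * a]) = f ([0][0 := sign \<epsilon> * K])" by blast
    then show ?thesis using \<open>K \<ge> 0\<close> by auto
  qed
  from this[of True] this[of False] obtain K L where
    KL: "K \<ge> 0" "\<forall>a\<ge>K. f [a] = f [K]" "L \<ge> 0" "\<forall>a\<ge>L. f [- a] = f [- L]"
    by (auto simp: sign_def)
  have "(\<forall>y\<ge>int K'. f [y] = f [int K']) \<and> (\<forall>y\<le>- int K'. f [y] = f [- int K'])"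
    if "K' \<ge> nat (max K L)" for K'
  proof -
    have K': "int K' \<ge> K" "int K' \<ge> L" using that by linarith+
    have "f [y] = f [int K']" if "y \<ge> int K'" for y
      using KL(2)[rule_format, of y] KL(2)[rule_format, of "int K'"] that K' by simp
    moreover have "f [y] = f [- int K']" if "y \<le> - int K'" for y
      using KL(4)[rule_format, of "- y"] KL(4)[rule_format, of "int K'"] that K' by simp
    ultimately show ?thesis by blast
  qed
  then show ?thesis by blast
qed

text \<open>Evaluated at \<open>j\<close>, the cube becomes a grid map into \<open>G\<close>. Beyond
  the stability bounds its faces are the four sides of the square with corners at \<open>- M\<close>
  and \<open>M\<close>, to which \<open>wind_square\<close> applies.\<close>

lemma (in cocycle) wind_cube:
  assumes S: "S \<in> cubes (graph_nerve (hom_graph A G)) (Suc (Suc 0))" and j: "j \<in> verts A"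
  defines "d \<equiv> \<lambda>i \<epsilon>. face (graph_nerve (hom_graph A G)) (Suc 0) i \<epsilon> S"
  shows "\<exists>K. \<forall>M\<ge>K.
    wind \<omega> M (\<lambda>x. d (Suc 0) False [x] j) + wind \<omega> M (\<lambda>y. d 0 True [y] j) =
    wind \<omega> M (\<lambda>y. d 0 False [y] j) + wind \<omega> M (\<lambda>x. d (Suc 0) True [x] j)"
proof -
  define s where "s x y = S [x, y] j" for x y
  have hom: "S \<in> graph_hom (grid (Suc (Suc 0))) (hom_graph A G)"
    using S by (simp add: graph_nerve_def)
  have edge: "(S v j, S w j) \<in> edges G" if "(v, w) \<in> edges (grid (Suc (Suc 0)))" for v w
    using hom that j by (force simp: graph_hom_def hom_graph_def)
  have "([x, y], [x + 1, y]) \<in> edges (grid (Suc (Suc 0)))" "([x, y], [x, y + 1]) \<in> edges (grid (Suc (Suc 0)))"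
    for x y :: int
    by (auto simp: grid_def tuples_def intro: exI[of _ 0] exI[of _ "Suc 0"])
  then have adj: "(s x y, s (x + 1) y) \<in> edges G" "(s x y, s x (y + 1)) \<in> edges G" for x y
    unfolding s_def by (blast intro: edge)+
  have one: "[y] \<in> tuples (Suc 0)" for y :: int by (simp add: tuples_def)
  have "\<exists>K. \<forall>M\<ge>K. \<forall>y. d i \<epsilon> [y] = S (ins_coord i (sign \<epsilon> * int M) [y])" if "i \<le> Suc 0" for i \<epsilon>
    unfolding d_def using face_eventually[OF S that, of \<epsilon>] one by blast
  then obtain K where K: "\<And>i \<epsilon> M y. i \<le> Suc 0 \<Longrightarrow> M \<ge> K i \<epsilon> \<Longrightarrow> d i \<epsilon> [y] = S (ins_coord i (sign \<epsilon> * int M) [y])"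
    by metis
  let ?K = "max (max (K 0 True) (K 0 False)) (max (K (Suc 0) True) (K (Suc 0) False))"
  have "d (Suc 0) False [x] j = s x (- int M)" "d 0 True [x] j = s (int M) x"
    "d 0 False [x] j = s (- int M) x" "d (Suc 0) True [x] j = s x (int M)" if "M \<ge> ?K" for M x
    using that by (simp_all add: K[where M = M] s_def sign_def)
  then show ?thesis
    using wind_square[of s, OF adj] by (intro exI[of _ ?K]) simp
qed

section \<open>Cycle graphs\<close>

definition cycle_graph :: "(nat \<Rightarrow> 'v) \<Rightarrow> nat \<Rightarrow> 'v graph" where
  "cycle_graph \<phi> N =
     \<lparr>verts = \<phi> ` {..<N},
      edges = {(\<phi> a, \<phi> b) | a b. a < N \<and> b < N \<and> (a = b \<or> b = Suc a mod N \<or> a = Suc b mod N)}\<rparr>"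

text \<open>The vertices live in \<open>'v\<close>, so positions are recovered by
  \<open>inv \<phi>\<close>; this gives a total function, as \<open>cocycle\<close> demands of
  \<open>\<omega>\<close>.\<close>

definition cycle_step :: "(nat \<Rightarrow> 'v) \<Rightarrow> nat \<Rightarrow> 'v \<Rightarrow> 'v \<Rightarrow> int" where
  "cycle_step \<phi> N x y =
     (if inv \<phi> y = Suc (inv \<phi> x) mod N then 1
      else if inv \<phi> x = Suc (inv \<phi> y) mod N then - 1 else 0)"

lemma simple_graph_cycle: "simple_graph (cycle_graph \<phi> N)"
  by (auto simp: simple_graph_def cycle_graph_def sym_def)

text \<open>A step is the difference of positions modulo \<open>N\<close>, lifted to
  \<open>-1\<close>, \<open>0\<close> or \<open>1\<close>. Squares are compared through this
  congruence.\<close>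

lemma cycle_step_dvd:
  assumes "inj \<phi>" and "(x, y) \<in> edges (cycle_graph \<phi> N)"
  shows "int N dvd int (inv \<phi> y) - int (inv \<phi> x) - cycle_step \<phi> N x y"
proof -
  have mod: "int N dvd int (Suc a mod N) - int a - 1" for a
    using mod_eq_dvd_iff[of "int (Suc a mod N)" "int N" "int a + 1"]
    by (simp add: zmod_int algebra_simps)
  obtain a b where ab: "x = \<phi> a" "y = \<phi> b" "a = b \<or> b = Suc a mod N \<or> a = Suc b mod N"
    using assms(2) by (auto simp: cycle_graph_def)
  show ?thesis
  proof (cases "b = Suc a mod N")
    case True
    then show ?thesis using mod[of a] assms(1) by (simp add: ab cycle_step_def)
  next
    case b: False
    show ?thesis
    proof (cases "a = Suc b mod N")
      case True
      then show ?thesis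
        using mod[of b] b assms(1) dvd_minus_iff[of "int N" "int a - int b - 1"]
        by (simp add: ab cycle_step_def algebra_simps)
    next
      case False
      then show ?thesis using b ab assms(1) by (simp add: cycle_step_def)
    qed
  qed
qed

text \<open>The two ways around a square share their end points, so their sums agree modulo
  \<open>N\<close>. Each sum lies between \<open>-2\<close> and \<open>2\<close>, so they differ by
  at most \<open>4\<close> and coincide once \<open>N\<close> is at least \<open>5\<close>.\<close>

lemma cocycle_cycle_step:
  assumes "inj \<phi>" and "N \<ge> 5"
  shows "cocycle (cycle_graph \<phi> N) (cycle_step \<phi> N)"
proof
  let ?\<omega> = "cycle_step \<phi> N"
  show abs: "\<bar>?\<omega> a b\<bar> \<le> 1" for a b by (simp add: cycle_step_def)
  show "?\<omega> a a = 0" for a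
  proof -
    have "inv \<phi> a \<noteq> Suc (inv \<phi> a) mod N"
    proof
      assume eq: "inv \<phi> a = Suc (inv \<phi> a) mod N"
      then have "inv \<phi> a < N" using assms(2) mod_less_divisor[of N "Suc (inv \<phi> a)"] by simp
      then have "Suc (inv \<phi> a) = N \<or> Suc (inv \<phi> a) < N" by auto
      then show False using eq assms(2) by auto
    qed
    then show ?thesis by (simp add: cycle_step_def)
  qed
  show "?\<omega> a b + ?\<omega> b c = ?\<omega> a d + ?\<omega> d c"
    if "(a, b) \<in> edges (cycle_graph \<phi> N)" "(b, c) \<in> edges (cycle_graph \<phi> N)"
      "(a, d) \<in> edges (cycle_graph \<phi> N)" "(d, c) \<in> edges (cycle_graph \<phi> N)" for a b c d
  proof -
    let ?n = "\<lambda>x. int (inv \<phi> x)"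
    have "int N dvd ((?n d - ?n a - ?\<omega> a d) + (?n c - ?n d - ?\<omega> d c)) -
        ((?n b - ?n a - ?\<omega> a b) + (?n c - ?n b - ?\<omega> b c))"
      using that by (intro dvd_diff dvd_add cycle_step_dvd[OF assms(1)])
    also have "\<dots> = (?\<omega> a b + ?\<omega> b c) - (?\<omega> a d + ?\<omega> d c)" by simp
    finally have dvd: "int N dvd (?\<omega> a b + ?\<omega> b c) - (?\<omega> a d + ?\<omega> d c)" .
    have "\<bar>(?\<omega> a b + ?\<omega> b c) - (?\<omega> a d + ?\<omega> d c)\<bar> < int N"
      using abs[of a b] abs[of b c] abs[of a d] abs[of d c] assms(2) by linarith
    then have "(?\<omega> a b + ?\<omega> b c) - (?\<omega> a d + ?\<omega> d c) = 0"
      using dvd_imp_le_int[OF _ dvd] by fastforce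
    then show ?thesis by simp
  qed
qed

lemma cycle_step_Suc:
  assumes "inj \<phi>"
  shows "cycle_step \<phi> N (\<phi> (c mod N)) (\<phi> (Suc c mod N)) = 1"
  using assms by (simp add: cycle_step_def mod_Suc_eq)

lemma wind_cycle:
  assumes "inj \<phi>" and "N \<ge> 5" and "M \<ge> N"
  shows "wind (cycle_step \<phi> N) M (\<lambda>y. \<phi> (nat (min y (int N)) mod N)) = int N"
proof -
  interpret cocycle "cycle_graph \<phi> N" "cycle_step \<phi> N" by (rule cocycle_cycle_step[OF assms(1,2)])
  let ?p = "\<lambda>y. \<phi> (nat (min y (int N)) mod N)"
  let ?t = "\<lambda>i. cycle_step \<phi> N (?p (int i - int M)) (?p (int i - int M + 1))"
  have "wind (cycle_step \<phi> N) M ?p = (\<Sum>i<2 * M. ?t i)" by (simp add: wind_def)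
  \<comment> \<open>Index \<open>M\<close> is position \<open>0\<close>. The path rests before it,
    because \<open>nat\<close> truncates, and from \<open>M + N\<close> on, because of
    \<open>min\<close>; \<open>M \<ge> N\<close> keeps all \<open>N\<close> moving steps in the
    window.\<close>
  also have "\<dots> = (\<Sum>i\<in>{M..<M + N}. ?t i)"
  proof (rule sum.mono_neutral_right)
    show "\<forall>i\<in>{..<2 * M} - {M..<M + N}. ?t i = 0"
    proof
      fix i assume "i \<in> {..<2 * M} - {M..<M + N}"
      then have "i < M \<or> M + N \<le> i" by auto
      then have "?p (int i - int M) = ?p (int i - int M + 1)" by auto
      then show "?t i = 0" by (simp only: refl_0)
    qed
  qed (use assms(3) in auto)
  also have "\<dots> = (\<Sum>i\<in>{M..<M + N}. 1)"
  proof (rule sum.cong)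
    fix i assume "i \<in> {M..<M + N}"
    then have "nat (min (int i - int M) (int N)) = i - M"
      "nat (min (int i - int M + 1) (int N)) = Suc (i - M)" by auto
    then show "?t i = 1" by (simp only: cycle_step_Suc[OF assms(1)])
  qed simp
  finally show ?thesis by simp
qed

section \<open>The square of a 3-simplex\<close>

abbreviation id_cube :: "nat \<Rightarrow> bool list \<Rightarrow> bool list" where
  "id_cube n \<equiv> restrict id (tuples n)"

definition restr_3 :: "(nat \<Rightarrow> nat) \<Rightarrow> (nat, bool list \<Rightarrow> bool list, 'p, 'd) cfun \<Rightarrow>
    (nat, bool list \<Rightarrow> bool list, 'p, 'd) cfun" where
  "restr_3 \<delta> F = cfun_comp (path_ccat 2) F (path_cfun 2 \<delta>)"

text \<open>The mapping object from \<open>0\<close> to \<open>2\<close> is an interval, so this is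
  the homotopy that fills the triangle, from its long edge at \<open>False\<close> to the composite
  of the other two at \<open>True\<close>.\<close>

definition edge_cube :: "(nat, bool list \<Rightarrow> bool list, 'p, 'd) cfun \<Rightarrow> 'd" where
  "edge_cube P = fmap P 0 2 (Suc 0) (id_cube (Suc 0))"

definition coface :: "nat \<Rightarrow> nat \<Rightarrow> nat" where
  "coface k = (\<lambda>i\<in>{..2}. if i < k then i else Suc i)"

lemma coface_simplex_op: "coface k \<in> simplex_op 2 3"
  by (auto simp: coface_def simplex_op_def intro!: mono_onI)

lemma coface_ends: "coface 1 0 = 0" "coface 1 2 = 3" "coface 2 0 = 0" "coface 2 2 = 3"
    "coface 3 0 = 0" "coface 3 2 = 2"
  by (simp_all add: coface_def)

lemma tuples_Suc_0: "v \<in> tuples (Suc 0) \<longleftrightarrow> (\<exists>b. v = [b])"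
  by (auto simp: tuples_Suc_conv)

lemma edge_cube_restr:
  "edge_cube (restr_3 (coface k) F) =
    fmap F (coface k 0) (coface k 2) (Suc 0)
      (compose (tuples (Suc 0)) (path_bits (coface k) 0 2) (id_cube (Suc 0)))"
  using box_hom_id[of "Suc 0"]
  by (simp add: edge_cube_def restr_3_def cfun_comp_def path_cfun_def del: tuples_0)

lemma fobj_restr: "i \<le> 2 \<Longrightarrow> fobj (restr_3 (coface k) F) i = fobj F (coface k i)"
  by (simp add: restr_3_def cfun_comp_def path_cfun_def compose_def)

lemma ex_between_0_2: "(\<exists>q::nat. 0 < q \<and> q < 2 \<and> X q) \<longleftrightarrow> X 1"
proof
  assume "\<exists>q::nat. 0 < q \<and> q < 2 \<and> X q"
  then obtain q :: nat where "0 < q" "q < 2" "X q" by blast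
  moreover have "q = 1" using \<open>0 < q\<close> \<open>q < 2\<close> by simp
  ultimately show "X 1" by simp
qed (auto intro: exI[of _ 1])

lemma path_bits_0_2: "path_bits \<delta> 0 2 [b] = map (\<lambda>p. \<delta> 1 = p \<and> b) [\<delta> 0 + 1..<\<delta> 2]"
  unfolding path_bits_def ex_between_0_2 by simp

text \<open>Omitting the object \<open>1\<close> or \<open>2\<close> sets its bit to
  \<open>False\<close>; omitting the last object leaves the single bit of \<open>1\<close>.\<close>

lemma path_bits_coface:
  "path_bits (coface 1) 0 2 [b] = [False, b]"
  "path_bits (coface 2) 0 2 [b] = [b, False]"
  "path_bits (coface 3) 0 2 [b] = [b]"
  unfolding path_bits_0_2 by (simp_all add: coface_def upt_rec)

text \<open>The two bits of the square tell whether the objects \<open>1\<close> and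
  \<open>2\<close> are visited. Its sides at \<open>False\<close> are the faces omitting these
  objects. Its sides at \<open>True\<close> are composites, since composition inserts
  \<open>True\<close>: through \<open>2\<close>, the last face followed by \<open>f\<close>; through
  \<open>1\<close>, the map \<open>w\<close> followed by the homotopy \<open>g\<close>.\<close>

lemma square_of_3_simplex:
  assumes "cubical_functor (path_ccat 3) Graph F"
  obtains S f g w where
    "S \<in> cubes (graph_nerve (hom_graph (fobj F 0) (fobj F 3))) (Suc (Suc 0))"
    "face (graph_nerve (hom_graph (fobj F 0) (fobj F 3))) (Suc 0) 0 False S = edge_cube (restr_3 (coface 1) F)"
    "face (graph_nerve (hom_graph (fobj F 0) (fobj F 3))) (Suc 0) (Suc 0) False S = edge_cube (restr_3 (coface 2) F)"
    "\<And>y. face (graph_nerve (hom_graph (fobj F 0) (fobj F 3))) (Suc 0) (Suc 0) True S [y] =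
      compose (verts (fobj F 0)) f (edge_cube (restr_3 (coface 3) F) [y])"
    "\<And>y. face (graph_nerve (hom_graph (fobj F 0) (fobj F 3))) (Suc 0) 0 True S [y] =
      compose (verts (fobj F 0)) (g y) w"
    "w \<in> graph_hom (fobj F 0) (fobj F 1)"
proof -
  interpret cubical_functor "path_ccat 3" Graph F by fact
  let ?X = "graph_nerve (hom_graph (fobj F 0) (fobj F 3))"
  define S where "S = fmap F 0 3 (Suc (Suc 0)) (id_cube (Suc (Suc 0)))"
  have id2: "id_cube (Suc (Suc 0)) \<in> cubes (maps (path_ccat 3) 0 3) (Suc (Suc 0))"
    using box_hom_id[of "Suc (Suc 0)"] by (simp add: numeral_2_eq_2)
  have id1: "id_cube (Suc 0) \<in> box_hom (Suc 0) (Suc 0)" and id0: "id_cube 0 \<in> box_hom 0 0"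
    by (rule box_hom_id)+
  have face: "face ?X (Suc 0) i \<epsilon> S =
      fmap F 0 3 (Suc 0) (compose (tuples (Suc 0)) (id_cube (Suc (Suc 0))) (ins_coord i \<epsilon>))"
    if "i \<le> Suc 0" for i \<epsilon>
    using fmap_face[OF _ _ id2 that, of \<epsilon>] by (simp add: S_def path_ccat_maps)
  have S: "S \<in> cubes ?X (Suc (Suc 0))"
    using PiE_mem[OF fmap_closed id2] by (simp add: S_def)
  moreover have "face ?X (Suc 0) 0 False S = edge_cube (restr_3 (coface 1) F)"
  proof -
    have "compose (tuples (Suc 0)) (id_cube (Suc (Suc 0))) (ins_coord 0 False) =
        compose (tuples (Suc 0)) (path_bits (coface 1) 0 2) (id_cube (Suc 0))"
      unfolding compose_def
      by (rule restrict_ext) (auto simp: tuples_Suc_conv path_bits_coface[unfolded One_nat_def])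
    then show ?thesis unfolding edge_cube_restr coface_ends using face[of 0 False] by simp
  qed
  moreover have "face ?X (Suc 0) (Suc 0) False S = edge_cube (restr_3 (coface 2) F)"
  proof -
    have "compose (tuples (Suc 0)) (id_cube (Suc (Suc 0))) (ins_coord (Suc 0) False) =
        compose (tuples (Suc 0)) (path_bits (coface 2) 0 2) (id_cube (Suc 0))"
      unfolding compose_def
      by (rule restrict_ext) (auto simp: tuples_Suc_conv path_bits_coface)
    then show ?thesis unfolding edge_cube_restr coface_ends using face[of "Suc 0" False] by simp
  qed
  moreover have "face ?X (Suc 0) (Suc 0) True S [y] =
      compose (verts (fobj F 0)) (fmap F 2 3 0 (id_cube 0) []) (edge_cube (restr_3 (coface 3) F) [y])" for y
  proof -
    have "compose (tuples (Suc 0)) (id_cube (Suc (Suc 0))) (ins_coord (Suc 0) True) =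
        ccomp (path_ccat 3) 0 2 3 (Suc 0) 0 (id_cube (Suc 0)) (id_cube 0)"
      by (auto simp: path_ccat_def compose_def tuples_def length_Suc_conv ins_coord_def
          simp del: tuples_0 intro!: restrict_ext)
    moreover have "fmap F 0 3 (Suc 0 + 0) (ccomp (path_ccat 3) 0 2 3 (Suc 0) 0 (id_cube (Suc 0)) (id_cube 0)) =
        ccomp Graph (fobj F 0) (fobj F 2) (fobj F 3) (Suc 0) 0
          (fmap F 0 2 (Suc 0) (id_cube (Suc 0))) (fmap F 2 3 0 (id_cube 0))"
      by (rule fmap_comp) (use id1 id0 in \<open>simp_all del: tuples_0\<close>)
    moreover have "edge_cube (restr_3 (coface 3) F) = fmap F 0 2 (Suc 0) (id_cube (Suc 0))"
    proof -
      have "compose (tuples (Suc 0)) (path_bits (coface 3) 0 2) (id_cube (Suc 0)) = id_cube (Suc 0)"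
        using path_bits_coface(3) by (auto simp: compose_def tuples_Suc_0 intro!: restrict_ext)
      then show ?thesis unfolding edge_cube_restr coface_ends by simp
    qed
    ultimately show ?thesis
      using face[of "Suc 0" True] by (simp add: Graph_def tuples_Suc_0)
  qed
  moreover have "face ?X (Suc 0) 0 True S [y] =
      compose (verts (fobj F 0)) (fmap F 1 3 (Suc 0) (id_cube (Suc 0)) [y]) (fmap F 0 1 0 (id_cube 0) [])" for y
  proof -
    have "compose (tuples (Suc 0)) (id_cube (Suc (Suc 0))) (ins_coord 0 True) =
        ccomp (path_ccat 3) 0 1 3 0 (Suc 0) (id_cube 0) (id_cube (Suc 0))"
      by (auto simp: path_ccat_def compose_def tuples_def length_Suc_conv
          simp del: tuples_0 intro!: restrict_ext)
    moreover have "fmap F 0 3 (0 + Suc 0) (ccomp (path_ccat 3) 0 1 3 0 (Suc 0) (id_cube 0) (id_cube (Suc 0))) =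
        ccomp Graph (fobj F 0) (fobj F 1) (fobj F 3) 0 (Suc 0)
          (fmap F 0 1 0 (id_cube 0)) (fmap F 1 3 (Suc 0) (id_cube (Suc 0)))"
      by (rule fmap_comp) (use id1 id0 in \<open>simp_all del: tuples_0\<close>)
    ultimately show ?thesis
      using face[of 0 True] by (simp add: Graph_def tuples_Suc_0)
  qed
  moreover have "fmap F 0 1 0 (id_cube 0) [] \<in> graph_hom (fobj F 0) (fobj F 1)"
  proof -
    have "fmap F 0 1 0 (id_cube 0) \<in> cubes (maps Graph (fobj F 0) (fobj F 1)) 0"
      by (rule PiE_mem[OF fmap_closed]) (use id0 in \<open>simp_all del: tuples_0\<close>)
    then have "fmap F 0 1 0 (id_cube 0) \<in> graph_hom (grid 0) (hom_graph (fobj F 0) (fobj F 1))"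
      by (simp add: graph_nerve_def)
    from graph_homD[OF this, of "[]"] show ?thesis by (simp add: grid_def)
  qed
  ultimately show ?thesis by (rule that)
qed

text \<open>The boundary of the square of a 3-simplex \<open>J \<rightarrow> I \<rightarrow> H \<rightarrow> G\<close> with \<open>I\<close> a single vertex, evaluated
  at two vertices of \<open>J\<close>: the side along \<open>J \<rightarrow> I\<close> does not depend on the vertex and cancels.\<close>

lemma (in cocycle) wind_3_simplex:
  assumes F: "cubical_functor (path_ccat 3) Graph F"
    and ob: "fobj F 0 = J" "fobj F 3 = G" and I: "verts (fobj F 1) = {i0}"
    and j: "j0 \<in> verts J" "j1 \<in> verts J"
    and bd: "\<And>j y. j \<in> verts J \<Longrightarrow> y \<ge> int K \<Longrightarrow>
        edge_cube (restr_3 (coface 3) F) [y] j = edge_cube (restr_3 (coface 3) F) [int K] j"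
      "\<And>j y. j \<in> verts J \<Longrightarrow> y \<le> - int K \<Longrightarrow>
        edge_cube (restr_3 (coface 3) F) [y] j = edge_cube (restr_3 (coface 3) F) [- int K] j"
  defines "W \<equiv> \<lambda>M k j. wind \<omega> M (\<lambda>y. edge_cube (restr_3 (coface k) F) [y] j)"
  shows "\<exists>L. \<forall>M\<ge>L. \<bar>(W M 2 j0 - W M 2 j1) - (W M 1 j0 - W M 1 j1)\<bar> \<le> 4 * int K"
proof -
  obtain S f g w where S:
    "S \<in> cubes (graph_nerve (hom_graph J G)) (Suc (Suc 0))"
    "face (graph_nerve (hom_graph J G)) (Suc 0) 0 False S = edge_cube (restr_3 (coface 1) F)"
    "face (graph_nerve (hom_graph J G)) (Suc 0) (Suc 0) False S = edge_cube (restr_3 (coface 2) F)"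
    "\<And>y. face (graph_nerve (hom_graph J G)) (Suc 0) (Suc 0) True S [y] =
      compose (verts J) f (edge_cube (restr_3 (coface 3) F) [y])"
    "\<And>y. face (graph_nerve (hom_graph J G)) (Suc 0) 0 True S [y] = compose (verts J) (g y) w"
    "w \<in> graph_hom J (fobj F 1)"
    by (rule square_of_3_simplex[OF F, unfolded ob]) (rule that; assumption)
  define T where "T M j = wind \<omega> M (\<lambda>y. f (edge_cube (restr_3 (coface 3) F) [y] j))" for M j
  define H where "H M = wind \<omega> M (\<lambda>y. g y i0)" for M
  have w: "w j = i0" if "j \<in> verts J" for j
    using graph_homD[OF S(6) that] I by simp
  have "\<exists>L. \<forall>M\<ge>L. W M 2 j + H M = W M 1 j + T M j" if "j \<in> verts J" for j
    using wind_cube[OF S(1) that] S(2-5) w[OF that] that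
    by (simp add: W_def T_def H_def compose_def)
  from this[OF j(1)] this[OF j(2)] obtain L0 L1 where
    L: "\<forall>M\<ge>L0. W M 2 j0 + H M = W M 1 j0 + T M j0" "\<forall>M\<ge>L1. W M 2 j1 + H M = W M 1 j1 + T M j1"
    by blast
  \<comment> \<open>\<open>f\<close> is applied pointwise to a path that rests outside
    \<open>{-K..K}\<close>; the image rests there as well, so the bound does not involve
    \<open>f\<close>.\<close>
  have T: "\<bar>T M j\<bar> \<le> 2 * int K" if "j \<in> verts J" for M j
    unfolding T_def using bd[OF that] by (intro wind_bounded) metis+
  show ?thesis
  proof (intro exI allI impI)
    \<comment> \<open>Subtracting the two equations removes \<open>H M\<close> and leaves
      \<open>T M j0 - T M j1\<close>.\<close>
    fix M assume "M \<ge> max L0 L1"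
    then have "W M 2 j0 + H M = W M 1 j0 + T M j0" "W M 2 j1 + H M = W M 1 j1 + T M j1"
      using L by simp_all
    then show "\<bar>(W M 2 j0 - W M 2 j1) - (W M 1 j0 - W M 1 j1)\<bar> \<le> 4 * int K"
      using T[OF j(1), of M] T[OF j(2), of M] by linarith
  qed
qed

section \<open>Cones under the span of one-point graphs\<close>

definition horn_edge :: "nat \<Rightarrow> nat \<Rightarrow> nat" where
  "horn_edge a = (\<lambda>i\<in>{..1}. i * a)"

lemma horn_edge_simps: "a \<in> {1, 2} \<Longrightarrow> horn_edge a \<in> simps (horn 2 0) 1"
proof -
  assume a: "a \<in> {1, 2}"
  then have "horn_edge a \<in> simplex_op 1 2"
    by (auto simp: horn_edge_def simplex_op_def intro!: mono_onI)
  moreover have "3 - a \<le> 2" "3 - a \<noteq> 0" "3 - a \<notin> horn_edge a ` {..1}"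
    using a by (auto simp: horn_edge_def le_Suc_eq)
  ultimately show "horn_edge a \<in> simps (horn 2 0) 1" unfolding horn_simps by blast
qed

text \<open>The vertices of \<open>z\<close> are \<open>0\<close>, \<open>a\<close>, the old tip and
  the new tip. Omitting \<open>a\<close> leaves a face that is the same for both values of
  \<open>a\<close>, along which the two 3-simplices cancel. Omitting the old tip leaves a simplex of
  the second cone, omitting the new tip one of the first.\<close>

lemma coface_act:
  fixes a :: nat
  defines "z \<equiv> JBoth 1 1 (horn_edge a) (\<lambda>i\<in>{..1}. i)"
    and "s \<equiv> \<lambda>k. sact (join (horn 2 0) (std_simplex 1)) 2 3 (coface k)"
  shows "s 1 z = JBoth 0 1 (\<lambda>i\<in>{..0}. 0) (\<lambda>i\<in>{..1}. i)"
    and "s 2 z = JBoth 1 0 (horn_edge a) (\<lambda>i\<in>{..0}. 1)"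
    and "s 3 z = JBoth 1 0 (horn_edge a) (\<lambda>i\<in>{..0}. 0)"
proof -
  have act: "s k z = JBoth r (2 - Suc r)
      (compose {..r} (horn_edge a) (restrict (coface k) {..r}))
      (compose {..2 - Suc r} (\<lambda>i\<in>{..1}. i) (\<lambda>i\<in>{..2 - Suc r}. coface k (Suc (i + r)) - Suc 1))"
    if "r < 2" "\<And>i. i \<le> 2 \<Longrightarrow> coface k i \<le> 1 \<longleftrightarrow> i \<le> r" for k r
    unfolding s_def z_def horn_simps(2)[symmetric, of r _ _ 2 0 1]
      std_simplex_simps(2)[symmetric, of "2 - Suc r" _ _ 1 1]
    using that by (rule join_act_both_both)
  show "s 1 z = JBoth 0 1 (\<lambda>i\<in>{..0}. 0) (\<lambda>i\<in>{..1}. i)"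
    by (subst act[of 0]) (auto simp: coface_def horn_edge_def compose_def intro!: restrict_ext)
  show "s 2 z = JBoth 1 0 (horn_edge a) (\<lambda>i\<in>{..0}. 1)"
    by (subst act[of 1]) (auto simp: coface_def horn_edge_def compose_def intro!: restrict_ext)
  show "s 3 z = JBoth 1 0 (horn_edge a) (\<lambda>i\<in>{..0}. 0)"
    by (subst act[of 1]) (auto simp: coface_def horn_edge_def compose_def intro!: restrict_ext)
qed

lemma level_coordinate: "level N (\<lambda>w. w ! 0) [y] = nat (min y (int N))"
proof -
  have "{t \<in> {1..N}. int t \<le> y} = {1..nat (min y (int N))}" by auto
  then show ?thesis by (simp add: level_def)
qed

lemma NGraph_simps: "F \<in> simps NGraph n \<longleftrightarrow> cubical_functor (path_ccat n) Graph F"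
  by (simp add: NGraph_def hc_nerve_def)

lemma NGraph_act: "sact NGraph 2 3 \<delta> F = restr_3 \<delta> F"
  by (simp add: NGraph_def hc_nerve_def restr_3_def)

lemma edge_cube_mem:
  assumes "cubical_functor (path_ccat 2) Graph P"
  shows "edge_cube P \<in> cubes (graph_nerve (hom_graph (fobj P 0) (fobj P 2))) (Suc 0)"
proof -
  interpret cubical_functor "path_ccat 2" Graph P by fact
  have "id_cube (Suc 0) \<in> cubes (maps (path_ccat 2) 0 2) (Suc 0)"
    using box_hom_id[of "Suc 0"] by simp
  then show ?thesis
    using PiE_mem[OF fmap_closed[of 0 2 "Suc 0"]] by (simp add: edge_cube_def)
qed

text \<open>The only intermediate object has label \<open>a\<close>, so its bit is counted exactly
  for \<open>a = 1\<close>: that triangle carries the loop, the other is constant.\<close>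

lemma (in loop_cone) edge_cube_simplex:
  "edge_cube (simplex 2 (join_label (JBoth 1 0 (horn_edge a) y))) [t] =
     (if a = 1 then R (nat (min t (int N))) else R 0)"
proof -
  define l where "l = join_label (JBoth 1 0 (horn_edge a) y)"
  have l: "l 0 = 0" "l 1 = a" "l 2 = 3"
    by (simp_all add: l_def join_label_def horn_edge_def)
  have "through_1 l 0 2 (id_cube (Suc 0)) w \<longleftrightarrow> a = 1 \<and> w ! 0" if "w \<in> tuples (Suc 0)" for w
    unfolding through_1_def ex_between_0_2 l(2) using that by simp
  then have "level_cube N (Suc 0) (through_1 l 0 2 (id_cube (Suc 0))) (arr 0 3) =
      level_cube N (Suc 0) (\<lambda>w. a = 1 \<and> w ! 0) (arr 0 3)"
    by (rule level_cube_cong)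
  moreover have "edge_cube (simplex 2 l) =
      level_cube N (Suc 0) (through_1 l 0 2 (id_cube (Suc 0))) (arr 0 3)"
    unfolding edge_cube_def using box_hom_id[of "Suc 0"] by (simp add: simplex_fmap l)
  ultimately show ?thesis
    unfolding l_def[symmetric] by (simp add: level_cube_def level_coordinate level_False arr_def tuples_def)
qed

section \<open>The graphs of the span and the comparison of winding numbers\<close>

lemma one_point_graph:
  assumes "graph_iso I (path_graph 0)"
  obtains i0 where "verts I = {i0}"
proof -
  obtain f where "bij_betw f (verts I) (verts (path_graph 0))"
    using assms by (auto simp: graph_iso_def)
  then have "card (verts I) = 1" by (simp add: bij_betw_same_card path_graph_def)
  then obtain i0 where "verts I = {i0}" by (rule card_1_singletonE)
  then show ?thesis by (rule that)
qed

lemma two_point_graph: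
  assumes "simple_graph J" and "graph_iso J (graph_sum (path_graph 0) (path_graph 0))"
  obtains j0 j1 where "verts J = {j0, j1}" "j0 \<noteq> j1" "\<And>x y. (x, y) \<in> edges J \<Longrightarrow> x = y"
proof -
  let ?S = "graph_sum (path_graph 0) (path_graph 0)"
  obtain f where f: "bij_betw f (verts J) (verts ?S)"
    "\<And>x y. x \<in> verts J \<Longrightarrow> y \<in> verts J \<Longrightarrow> (x, y) \<in> edges J \<longleftrightarrow> (f x, f y) \<in> edges ?S"
    using assms(2) by (auto simp: graph_iso_def)
  have "card (verts J) = card (verts ?S)" using bij_betw_same_card[OF f(1)] .
  also have "verts ?S = {Inl 0, Inr 0}" by (auto simp: graph_sum_def path_graph_def)
  finally have "card (verts J) = 2" by simp
  then obtain j0 j1 where "verts J = {j0, j1}" "j0 \<noteq> j1" by (auto simp: card_2_iff)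
  moreover have "x = y" if "(x, y) \<in> edges J" for x y
  proof -
    have xy: "x \<in> verts J" "y \<in> verts J" using assms(1) that by (auto simp: simple_graph_def)
    then have "f x = f y"
      using f(2)[OF xy] that by (auto simp: graph_sum_def path_graph_def)
    then show ?thesis using f(1) xy by (auto simp: bij_betw_def dest: inj_onD)
  qed
  ultimately show ?thesis by (rule that)
qed

lemma exists_cone_without_map:
  fixes I J :: "'v::infinite graph" and u :: "'v \<Rightarrow> 'v"
  defines "D \<equiv> horn_span NGraph (graph_edge J I u) (graph_edge J I u)"
  assumes I: "simple_graph I" and J: "simple_graph J" and u: "u \<in> graph_hom J I"
    and i0: "verts I = {i0}" and j01: "verts J = {j0, j1}" "j0 \<noteq> j1"
    and edges_J: "\<And>x y. (x, y) \<in> edges J \<Longrightarrow> x = y"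
    and c: "is_cone (horn 2 0) NGraph D c"
  shows "\<exists>c'. is_cone (horn 2 0) NGraph D c' \<and> \<not> (\<exists>h. is_cone_map (horn 2 0) NGraph c c' h)"
proof -
  define P where "P a = c 2 (JBoth 1 0 (horn_edge a) (\<lambda>i\<in>{..0}. 0))" for a
  have z0: "JBoth 1 0 (horn_edge a) (\<lambda>i\<in>{..0}. 0) \<in> simps (join (horn 2 0) (std_simplex 0)) 2"
    if "a \<in> {1, 2}" for a
    using horn_edge_simps[OF that] const_simplex_op[of 0 0 0]
    by (intro join_simpsI(3)) (simp_all only: std_simplex_simps)
  have "\<exists>K. \<forall>K'\<ge>K. (\<forall>y\<ge>int K'. edge_cube (P a) [y] = edge_cube (P a) [int K']) \<and>
      (\<forall>y\<le>- int K'. edge_cube (P a) [y] = edge_cube (P a) [- int K'])" if "a \<in> {1, 2}" for a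
  proof (rule cube_1_bounded, rule edge_cube_mem)
    show "cubical_functor (path_ccat 2) Graph (P a)"
      using c z0[OF that] unfolding P_def NGraph_simps[symmetric] is_cone_def
      by (blast intro: simplicial_mapD(1))
  qed
  from this[of 1] this[of 2] obtain K1 K2 where
    "\<forall>K'\<ge>K1. (\<forall>y\<ge>int K'. edge_cube (P 1) [y] = edge_cube (P 1) [int K']) \<and>
      (\<forall>y\<le>- int K'. edge_cube (P 1) [y] = edge_cube (P 1) [- int K'])"
    "\<forall>K'\<ge>K2. (\<forall>y\<ge>int K'. edge_cube (P 2) [y] = edge_cube (P 2) [int K']) \<and>
      (\<forall>y\<le>- int K'. edge_cube (P 2) [y] = edge_cube (P 2) [- int K'])"
    by blast
  then obtain K where K: "\<And>a y. a \<in> {1, 2} \<Longrightarrow> y \<ge> int K \<Longrightarrow> edge_cube (P a) [y] = edge_cube (P a) [int K]"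
    "\<And>a y. a \<in> {1, 2} \<Longrightarrow> y \<le> - int K \<Longrightarrow> edge_cube (P a) [y] = edge_cube (P a) [- int K]"
    using max.cobounded1[of K1 K2] max.cobounded2[of K2 K1] that[of "max K1 K2"] by blast
  \<comment> \<open>\<open>8 * K\<close> is the bound for two 3-simplices at two vertices of
    \<open>J\<close>; adding \<open>5\<close> exceeds it and meets the condition for the cocycle
    even if \<open>K = 0\<close>.\<close>
  define N where "N = 8 * K + 5"
  have N: "N \<ge> 5" by (simp add: N_def)
  \<comment> \<open>Infinity of the universe \<open>'v\<close> makes room for cycles of every
    length.\<close>
  obtain \<phi> :: "nat \<Rightarrow> 'v" where \<phi>: "inj \<phi>"
    using infinite_countable_subset[OF infinite_UNIV] by blast
  define G where "G = cycle_graph \<phi> N"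
  define leg where "leg = (\<lambda>i\<in>verts I. \<phi> 0)"
  \<comment> \<open>The loop runs at \<open>j0\<close> only, which is a graph map because
    \<open>J\<close> has no edge between its two vertices. It closes up since
    \<open>N mod N = 0\<close>.\<close>
  define R where "R c = (\<lambda>j\<in>verts J. if j = j0 then \<phi> (c mod N) else \<phi> 0)" for c
  have edge: "(\<phi> a, \<phi> b) \<in> edges G" if "a < N" "b < N" "a = b \<or> b = Suc a mod N" for a b
    unfolding G_def cycle_graph_def using that by auto
  have G: "\<phi> (c mod N) \<in> verts G" "(\<phi> (c mod N), \<phi> (c mod N)) \<in> edges G"
    "(\<phi> (c mod N), \<phi> (Suc c mod N)) \<in> edges G" for c
    using N by (auto simp: G_def[THEN arg_cong[where f = verts]] cycle_graph_def mod_Suc_eq intro: edge)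
  have G0: "\<phi> 0 \<in> verts G" "(\<phi> 0, \<phi> 0) \<in> edges G" using G(1,2)[of 0] by simp_all
  have R_hom: "R c \<in> graph_hom J G" for c
  proof -
    have "y = x \<and> x \<in> verts J" if "(x, y) \<in> edges J" for x y
      using edges_J[OF that] that J by (auto simp: simple_graph_def)
    then show ?thesis using G G0 by (force simp: graph_hom_def R_def)
  qed
  interpret loop_cone I J G u leg N R
  proof
    show "simple_graph G" unfolding G_def by (rule simple_graph_cycle)
    show "leg \<in> graph_hom I G"
      using G0 I by (auto simp: graph_hom_def leg_def simple_graph_def)
    show "R c \<in> graph_hom J G" for c by (rule R_hom)
    show "(R c, R (Suc c)) \<in> edges (hom_graph J G)" for c
      using R_hom G G0 by (auto simp: hom_graph_def R_def)
    show "R 0 = compose (verts J) leg u" "R N = compose (verts J) leg u"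
      using graph_homD[OF u] by (auto simp: R_def leg_def compose_def intro!: restrict_ext)
  qed (fact I J u)+
  interpret cocycle G "cycle_step \<phi> N" unfolding G_def by (rule cocycle_cycle_step[OF \<phi> N])
  define c' :: "nat \<Rightarrow> (nat \<Rightarrow> nat, nat \<Rightarrow> nat) join_simplex \<Rightarrow> _"
    where "c' n z = simplex n (join_label z)" for n z
  have "is_cone (horn 2 0) NGraph D c'"
    using is_cone_simplex unfolding D_def c'_def .
  moreover have "\<not> is_cone_map (horn 2 0) NGraph c c' h" for h
  proof
    assume h: "is_cone_map (horn 2 0) NGraph c c' h"
    define F where "F a = h 3 (JBoth 1 1 (horn_edge a) (\<lambda>i\<in>{..1}. i))" for a
    define Q where "Q = h 2 (JBoth 0 1 (\<lambda>i\<in>{..0}. 0) (\<lambda>i\<in>{..1}. i))"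
    have map: "simplicial_map (join (horn 2 0) (std_simplex 1)) NGraph h"
      using h by (simp add: is_cone_map_def)
    have id1: "(\<lambda>i\<in>{..1}. i) \<in> simplex_op 1 1" by (auto simp: simplex_op_def intro!: mono_onI)
    have z: "JBoth 1 1 (horn_edge a) (\<lambda>i\<in>{..1}. i) \<in> simps (join (horn 2 0) (std_simplex 1)) 3"
      if "a \<in> {1, 2}" for a
      using horn_edge_simps[OF that] id1 by (intro join_simpsI(3)) (simp_all add: std_simplex_simps)
    have F: "cubical_functor (path_ccat 3) Graph (F a)" if "a \<in> {1, 2}" for a
      using simplicial_mapD(1)[OF map z[OF that]] by (simp add: F_def NGraph_simps)
    have restr: "restr_3 (coface k) (F a) =
        h 2 (sact (join (horn 2 0) (std_simplex 1)) 2 3 (coface k) (JBoth 1 1 (horn_edge a) (\<lambda>i\<in>{..1}. i)))"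
      if "a \<in> {1, 2}" for k a
      using simplicial_mapD(2)[OF map coface_simplex_op z[OF that]] by (simp add: F_def NGraph_act)
    have ends: "h 2 (JBoth 1 0 (horn_edge a) (\<lambda>i\<in>{..0}. 0)) = P a"
      "h 2 (JBoth 1 0 (horn_edge a) (\<lambda>i\<in>{..0}. 1)) = c' 2 (JBoth 1 0 (horn_edge a) (\<lambda>i\<in>{..0}. 0))"
      if "a \<in> {1, 2}" for a
      using h z0[OF that] unfolding is_cone_map_def P_def
      by (force simp: join_map_def vertex_map_def)+
    have faces: "restr_3 (coface 1) (F a) = Q"
      "restr_3 (coface 2) (F a) = simplex 2 (join_label (JBoth 1 0 (horn_edge a) (\<lambda>i\<in>{..0::nat}. 0::nat)))"
      "restr_3 (coface 3) (F a) = P a" if "a \<in> {1, 2}" for a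
      unfolding restr[OF that] coface_act ends[OF that] Q_def c'_def by (rule refl)+
    \<comment> \<open>The objects are read off the face omitting the old tip, which is an explicit
      simplex of the cone \<open>c'\<close>.\<close>
    have obs: "fobj (F a) 0 = J" "verts (fobj (F a) 1) = {i0}" "fobj (F a) 3 = G" if a: "a \<in> {1, 2}" for a
    proof -
      define l where "l = join_label (JBoth 1 0 (horn_edge a) (\<lambda>i\<in>{..0::nat}. 0::nat))"
      have l: "l 0 = 0" "l 1 = a" "l 2 = 3"
        by (simp_all add: l_def join_label_def horn_edge_def)
      have fobj: "fobj (F a) (coface 2 i) = ob (l i)" if "i \<le> 2" for i
        using fobj_restr[OF that, of 2 "F a"] simplex_fobj[OF that]
        unfolding faces(2)[OF a] l_def[symmetric] by simp
      have "coface 2 1 = 1" by (simp add: coface_def)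
      then have "fobj (F a) 1 = ob a" using fobj[of 1] unfolding l by simp
      moreover have "ob a = I" using a by (auto simp: ob_def)
      ultimately show "verts (fobj (F a) 1) = {i0}" using i0 by simp
      show "fobj (F a) 0 = J" using fobj[of 0] unfolding l coface_ends by (simp add: ob_def)
      show "fobj (F a) 3 = G" using fobj[of 2] unfolding l coface_ends by (simp add: ob_def)
    qed
    define W where "W M E j = wind (cycle_step \<phi> N) M (\<lambda>y. edge_cube E [y] j)" for M j
        and E :: "(nat, bool list \<Rightarrow> bool list, 'v graph, int list \<Rightarrow> 'v \<Rightarrow> 'v) cfun"
    have "\<exists>L. \<forall>M\<ge>L. \<bar>(W M (restr_3 (coface 2) (F a)) j0 - W M (restr_3 (coface 2) (F a)) j1) -
        (W M Q j0 - W M Q j1)\<bar> \<le> 4 * int K" if "a \<in> {1, 2}" for a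
      unfolding W_def faces(1)[OF that, symmetric]
    proof (rule wind_3_simplex[OF F[OF that] obs(1,3,2)[OF that]])
      show "j0 \<in> verts J" "j1 \<in> verts J" using j01 by simp_all
      show "edge_cube (restr_3 (coface 3) (F a)) [y] j = edge_cube (restr_3 (coface 3) (F a)) [int K] j"
        if "y \<ge> int K" for j y
        unfolding faces(3)[OF \<open>a \<in> {1, 2}\<close>] using K(1)[OF \<open>a \<in> {1, 2}\<close> that] by (rule fun_cong)
      show "edge_cube (restr_3 (coface 3) (F a)) [y] j = edge_cube (restr_3 (coface 3) (F a)) [- int K] j"
        if "y \<le> - int K" for j y
        unfolding faces(3)[OF \<open>a \<in> {1, 2}\<close>] using K(2)[OF \<open>a \<in> {1, 2}\<close> that] by (rule fun_cong)
    qed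
    from this[of 1] this[of 2] obtain L1 L2 where L:
      "\<forall>M\<ge>L1. \<bar>(W M (restr_3 (coface 2) (F 1)) j0 - W M (restr_3 (coface 2) (F 1)) j1) -
        (W M Q j0 - W M Q j1)\<bar> \<le> 4 * int K"
      "\<forall>M\<ge>L2. \<bar>(W M (restr_3 (coface 2) (F 2)) j0 - W M (restr_3 (coface 2) (F 2)) j1) -
        (W M Q j0 - W M Q j1)\<bar> \<le> 4 * int K"
      by auto
    \<comment> \<open>A single window for both 3-simplices makes the contributions of
      \<open>Q\<close> equal; \<open>N\<close> is included for \<open>wind_cycle\<close>.\<close>
    define M where "M = max N (max L1 L2)"
    have M: "M \<ge> N" "M \<ge> L1" "M \<ge> L2" by (auto simp: M_def)
    have val: "edge_cube (restr_3 (coface 2) (F a)) [y] = (if a = 1 then R (nat (min y (int N))) else R 0)"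
      if "a \<in> {1, 2}" for a y
      unfolding faces(2)[OF that] by (rule edge_cube_simplex)
    have "W M (restr_3 (coface 2) (F 1)) j0 = int N"
      using wind_cycle[OF \<phi> N M(1)] j01 by (simp add: W_def val R_def)
    moreover have "W M (restr_3 (coface 2) (F 1)) j1 = 0" "W M (restr_3 (coface 2) (F 2)) j0 = 0"
      "W M (restr_3 (coface 2) (F 2)) j1 = 0"
      using j01 unfolding W_def by (auto intro!: wind_const simp: val R_def)
    \<comment> \<open>With \<open>q = W M Q j0 - W M Q j1\<close> the two bounds read
      \<open>\<bar>N - q\<bar> \<le> 4 * K\<close> and \<open>\<bar>q\<bar> \<le> 4 * K\<close>,
      hence \<open>N \<le> 8 * K\<close>, against the choice of \<open>N\<close>.\<close>
    ultimately show False
      using L[rule_format] M N_def by fastforce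
  qed
  ultimately show ?thesis by blast
qed

theorem theorem2:
  fixes I J :: "'v::infinite graph" and u :: "'v \<Rightarrow> 'v"
    and D :: "nat \<Rightarrow> (nat \<Rightarrow> nat) \<Rightarrow>
      (nat, bool list \<Rightarrow> bool list, 'v graph, int list \<Rightarrow> 'v \<Rightarrow> 'v) cfun"
  assumes "simple_graph I" and "graph_iso I (path_graph 0)"
    and "simple_graph J" and "graph_iso J (graph_sum (path_graph 0) (path_graph 0))"
    and "u \<in> graph_hom J I"
    and "D = horn_span NGraph (graph_edge J I u) (graph_edge J I u)"
  shows "(\<forall>c. is_cone (horn 2 0) NGraph D c \<longrightarrow>
            (\<exists>c'. is_cone (horn 2 0) NGraph D c' \<and>
              \<not> (\<exists>h. is_cone_map (horn 2 0) NGraph c c' h))) \<and>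
         \<not> (\<exists>c. is_colimit (horn 2 0) NGraph D c)"
proof -
  obtain i0 where "verts I = {i0}" using one_point_graph[OF assms(2)] .
  moreover obtain j0 j1 where "verts J = {j0, j1}" "j0 \<noteq> j1" "\<And>x y. (x, y) \<in> edges J \<Longrightarrow> x = y"
    by (rule two_point_graph[OF assms(3,4)]) (rule that; assumption)
  ultimately have *: "\<exists>c'. is_cone (horn 2 0) NGraph D c' \<and> \<not> (\<exists>h. is_cone_map (horn 2 0) NGraph c c' h)"
    if "is_cone (horn 2 0) NGraph D c" for c
    using exists_cone_without_map[OF assms(1,3,5)] that unfolding assms(6) by blast
  moreover have "\<not> is_colimit (horn 2 0) NGraph D c" for c
  proof
    assume c: "is_colimit (horn 2 0) NGraph D c"
    then have "is_cone (horn 2 0) NGraph D c" unfolding is_colimit_def by (rule conjunct1)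
    from *[OF this] obtain c' where
      c': "is_cone (horn 2 0) NGraph D c'" "\<not> (\<exists>h. is_cone_map (horn 2 0) NGraph c c' h)"
      by (elim exE conjE)
    have "\<exists>h. is_cone_map (horn 2 0) NGraph c c' h"
      by (rule colimit_cone_map[OF _ c c'(1)]) (rule horn_act_closed)
    then show False using c'(2) by (rule notE[rotated])
  qed
  ultimately show ?thesis by blast
qed

end
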